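(* Let $(W,\omega)$ be a real symplectic vector space of dimension $2n$ and let $C\subset\mathscr{L}(W)$ be a regular cycle. Then for each $\Lambda\in C$, $C\setminus\{\Lambda\}$ is a (regular) Jacobi curve, and every projective reparametrization $\Gamma=\Gamma(t)$ of it has vanishing curvature operator, $R_\Gamma(t)=0$ for all $t$.
   Context: $(u|v):=\omega(u,v)$. $\mathscr{L}(W)$ is the Lagrangian Grassmannian; $\Lambda^{\pitchfork}$ is the open set of Lagrangian subspaces transverse to $\Lambda$. Affine structure: for $\Gamma_0\in\Delta^{\pitchfork}$, each $\Gamma\in\Delta^{\pitchfork}$ is the graph of a unique linear map $\Gamma_0\to\Delta$, and this identifies $\Delta^{\pitchfork}$ with the vector space of linear maps $A\colon\Gamma_0\to\Delta$ with $(Au|v)+(u|Av)=0$; the affine structure so defined on $\Delta^{\pitchfork}$ is independent of the origin $\Gamma_0$. An affine line $L$ in $\overline\Lambda^{\pitchfork}$ ($\overline\Lambda\in\mathscr{L}(W)$) is regular if $\Lambda_1\cap\Lambda_2=\{0\}$ for all $\Lambda_1\neq\Lambda_2$ in $L$. A cycle is a set $C=L\cup\{\overline\Lambda\}$ with $\overline\Lambda\in\mathscr{L}(W)$ and $L$ an affine line in $\overline\Lambda^{\pitchfork}$; it is regular if $L$ is regular. A (regular) Jacobi curve is a smooth curve $\Gamma(t)$ in $\mathscr{L}(W)$, $t$ in an open interval, such that for every $t_0$ the quadratic form $\dot\Gamma(t_0)(v_0)=\omega(v_0,v'(t_0))$ on $\Gamma(t_0)$ (with $v(t)\in\Gamma(t)$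 any smooth curve, $v(t_0)=v_0$) is non-degenerate; a subset of $\mathscr{L}(W)$ is called a Jacobi curve if it is the image of an injective such curve, and its parametrizations are the smooth reparametrizations (with nowhere vanishing derivative) of it. For a Jacobi curve and each $\tau$ there is a unique $\Delta_\tau\in\Gamma(\tau)^{\pitchfork}$ such that $\Gamma$, viewed for $t$ near $\tau$ as a curve $\Gamma_{\Delta_\tau}$ in the affine space $\Delta_\tau^{\pitchfork}$, satisfies $\Gamma''_{\Delta_\tau}(\tau)=0$. With $\Gamma(\tau)$ as origin, $\Gamma'_{\Delta_\tau}(\tau)$ and $\Gamma'''_{\Delta_\tau}(\tau)$ are linear maps $\Gamma(\tau)\to\Delta_\tau$, the first invertible; the (Ricci) curvature operator is $R_\Gamma(\tau)=(\Gamma'_{\Delta_\tau}(\tau))^{-1}\circ\Gamma'''_{\Delta_\tau}(\tau)\colon\Gamma(\tau)\to\Gamma(\tau)$. A parametrization is projective if $\mathrm{tr}\,R_\Gamma(t)=0$ for all $t$. *)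

theory Defs
  imports "HOL-Analysis.Analysis"
begin

section \<open>Symplectic linear algebra\<close>

definition symplectic_form :: "('a::euclidean_space \<Rightarrow> 'a \<Rightarrow> real) \<Rightarrow> bool" where
  "symplectic_form \<omega> \<longleftrightarrow>
     bilinear \<omega> \<and> (\<forall>v. \<omega> v v = 0) \<and> (\<forall>u. (\<forall>v. \<omega> u v = 0) \<longrightarrow> u = 0)"

definition lagrangian_grassmannian ::
    "('a::euclidean_space \<Rightarrow> 'a \<Rightarrow> real) \<Rightarrow> 'a set set" where
  "lagrangian_grassmannian \<omega> =
     {\<Lambda>. subspace \<Lambda> \<and> (\<forall>u\<in>\<Lambda>. \<forall>v\<in>\<Lambda>. \<omega> u v = 0) \<and> 2 * dim \<Lambda> = DIM('a)}"

definition transversals ::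
    "('a::euclidean_space \<Rightarrow> 'a \<Rightarrow> real) \<Rightarrow> 'a set \<Rightarrow> 'a set set" where
  "transversals \<omega> \<Lambda> = {\<Gamma> \<in> lagrangian_grassmannian \<omega>. \<Gamma> \<inter> \<Lambda> = {0}}"


section \<open>The affine structure on the set of transversals\<close>

text \<open>
  Let \<open>\<Gamma>\<^sub>0\<close> be transverse to \<open>\<Delta>\<close>. A linear map from \<open>\<Gamma>\<^sub>0\<close> to \<open>\<Delta>\<close> is
  represented by its extension by zero on \<open>\<Delta>\<close> to the whole space, which is the direct sum of
  \<open>\<Gamma>\<^sub>0\<close> and \<open>\<Delta>\<close>. These extensions are the linear maps that take values in \<open>\<Delta>\<close> and
  vanish on \<open>\<Delta>\<close>; they form a vector subspace of the space of all linear maps.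
\<close>

definition lin_maps :: "'a::euclidean_space set \<Rightarrow> ('a \<Rightarrow>\<^sub>L 'a) set" where
  "lin_maps \<Delta> = {A. (\<forall>w. blinfun_apply A w \<in> \<Delta>) \<and> (\<forall>w\<in>\<Delta>. blinfun_apply A w = 0)}"

definition symmetric_maps ::
    "('a::euclidean_space \<Rightarrow> 'a \<Rightarrow> real) \<Rightarrow> 'a set \<Rightarrow> 'a set \<Rightarrow> ('a \<Rightarrow>\<^sub>L 'a) set" where
  "symmetric_maps \<omega> \<Gamma>\<^sub>0 \<Delta> =
     {A \<in> lin_maps \<Delta>. \<forall>u\<in>\<Gamma>\<^sub>0. \<forall>v\<in>\<Gamma>\<^sub>0. \<omega> (blinfun_apply A u) v + \<omega> u (blinfun_apply A v) = 0}"

definition graph_over :: "'a::euclidean_space set \<Rightarrow> ('a \<Rightarrow>\<^sub>L 'a) \<Rightarrow> 'a set" where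
  "graph_over \<Gamma>\<^sub>0 A = (\<lambda>u. u + blinfun_apply A u) ` \<Gamma>\<^sub>0"

definition graph_chart ::
    "'a::euclidean_space set \<Rightarrow> 'a set \<Rightarrow> 'a set \<Rightarrow> ('a \<Rightarrow>\<^sub>L 'a)" where
  "graph_chart \<Gamma>\<^sub>0 \<Delta> \<Gamma> = (THE A. A \<in> lin_maps \<Delta> \<and> \<Gamma> = graph_over \<Gamma>\<^sub>0 A)"

definition affine_line ::
    "('a::euclidean_space \<Rightarrow> 'a \<Rightarrow> real) \<Rightarrow> 'a set \<Rightarrow> 'a set set \<Rightarrow> bool" where
  "affine_line \<omega> \<Delta> L \<longleftrightarrow>
     (\<exists>\<Gamma>\<^sub>0\<in>transversals \<omega> \<Delta>. \<exists>A\<in>symmetric_maps \<omega> \<Gamma>\<^sub>0 \<Delta>. \<exists>B\<in>symmetric_maps \<omega> \<Gamma>\<^sub>0 \<Delta>.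
        B \<noteq> 0 \<and> L = range (\<lambda>s::real. graph_over \<Gamma>\<^sub>0 (A + s *\<^sub>R B)))"

definition regular_line :: "'a::euclidean_space set set \<Rightarrow> bool" where
  "regular_line L \<longleftrightarrow> (\<forall>\<Lambda>\<^sub>1\<in>L. \<forall>\<Lambda>\<^sub>2\<in>L. \<Lambda>\<^sub>1 \<noteq> \<Lambda>\<^sub>2 \<longrightarrow> \<Lambda>\<^sub>1 \<inter> \<Lambda>\<^sub>2 = {0})"

definition regular_cycle ::
    "('a::euclidean_space \<Rightarrow> 'a \<Rightarrow> real) \<Rightarrow> 'a set set \<Rightarrow> bool" where
  "regular_cycle \<omega> C \<longleftrightarrow>
     (\<exists>\<Delta>\<in>lagrangian_grassmannian \<omega>. \<exists>L. affine_line \<omega> \<Delta> L \<and> regular_line L \<and> C = insert \<Delta> L)"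


section \<open>Smooth curves\<close>

definition nth_deriv :: "nat \<Rightarrow> (real \<Rightarrow> 'b::real_normed_vector) \<Rightarrow> real \<Rightarrow> 'b" where
  "nth_deriv k f = ((\<lambda>g t. vector_derivative g (at t)) ^^ k) f"

definition smooth_on :: "real set \<Rightarrow> (real \<Rightarrow> 'b::real_normed_vector) \<Rightarrow> bool" where
  "smooth_on U f \<longleftrightarrow> (\<forall>k. \<forall>t\<in>U. nth_deriv k f differentiable (at t))"

definition open_interval :: "real set \<Rightarrow> bool" where
  "open_interval I \<longleftrightarrow> open I \<and> is_interval I \<and> I \<noteq> {}"

text \<open>Smoothness with respect to the atlas of the graph charts.\<close>

definition smooth_lagrangian_curve ::
    "('a::euclidean_space \<Rightarrow> 'a \<Rightarrow> real) \<Rightarrow> real set \<Rightarrow> (real \<Rightarrow> 'a set) \<Rightarrow> bool" where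
  "smooth_lagrangian_curve \<omega> I \<Gamma> \<longleftrightarrow>
     (\<forall>t\<in>I. \<Gamma> t \<in> lagrangian_grassmannian \<omega>) \<and>
     (\<forall>\<tau>\<in>I. \<exists>\<Delta>\<in>lagrangian_grassmannian \<omega>. \<exists>\<Gamma>\<^sub>0\<in>transversals \<omega> \<Delta>. \<exists>U\<subseteq>I.
        open U \<and> \<tau> \<in> U \<and> (\<forall>t\<in>U. \<Gamma> t \<in> transversals \<omega> \<Delta>) \<and>
        smooth_on U (\<lambda>t. graph_chart \<Gamma>\<^sub>0 \<Delta> (\<Gamma> t)))"


section \<open>Jacobi curves\<close>

text \<open>
  The value does not depend on the smooth curve \<open>v\<close>: two choices differ by a smooth curve in
  \<open>\<Gamma>\<close> that vanishes at \<open>\<tau>\<close>, hence has its derivative at \<open>\<tau>\<close> in the isotropic space \<open>\<Gamma> \<tau>\<close>.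
\<close>

definition velocity_form ::
    "('a::euclidean_space \<Rightarrow> 'a \<Rightarrow> real) \<Rightarrow> (real \<Rightarrow> 'a set) \<Rightarrow> real \<Rightarrow> 'a \<Rightarrow> real" where
  "velocity_form \<omega> \<Gamma> \<tau> v\<^sub>0 =
     (THE c. \<exists>v U. open U \<and> \<tau> \<in> U \<and> smooth_on U v \<and> (\<forall>t\<in>U. v t \<in> \<Gamma> t) \<and> v \<tau> = v\<^sub>0 \<and>
        c = \<omega> v\<^sub>0 (vector_derivative v (at \<tau>)))"

definition nondegenerate_quadratic_on :: "'a::real_vector set \<Rightarrow> ('a \<Rightarrow> real) \<Rightarrow> bool" where
  "nondegenerate_quadratic_on S q \<longleftrightarrow>
     (\<forall>u\<in>S. (\<forall>v\<in>S. q (u + v) - q u - q v = 0) \<longrightarrow> u = 0)"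

definition jacobi_curve ::
    "('a::euclidean_space \<Rightarrow> 'a \<Rightarrow> real) \<Rightarrow> real set \<Rightarrow> (real \<Rightarrow> 'a set) \<Rightarrow> bool" where
  "jacobi_curve \<omega> I \<Gamma> \<longleftrightarrow>
     open_interval I \<and> smooth_lagrangian_curve \<omega> I \<Gamma> \<and>
     (\<forall>\<tau>\<in>I. nondegenerate_quadratic_on (\<Gamma> \<tau>) (velocity_form \<omega> \<Gamma> \<tau>))"

definition injective_jacobi_curve_onto ::
    "('a::euclidean_space \<Rightarrow> 'a \<Rightarrow> real) \<Rightarrow> 'a set set \<Rightarrow> real set \<Rightarrow> (real \<Rightarrow> 'a set) \<Rightarrow> bool" where
  "injective_jacobi_curve_onto \<omega> S I \<Gamma> \<longleftrightarrow> jacobi_curve \<omega> I \<Gamma> \<and> inj_on \<Gamma> I \<and> \<Gamma> ` I = S"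

definition is_jacobi_curve_set ::
    "('a::euclidean_space \<Rightarrow> 'a \<Rightarrow> real) \<Rightarrow> 'a set set \<Rightarrow> bool" where
  "is_jacobi_curve_set \<omega> S \<longleftrightarrow> (\<exists>I \<Gamma>. injective_jacobi_curve_onto \<omega> S I \<Gamma>)"

text \<open>
  The change of parameter \<open>\<phi>\<close> need not be onto \<open>I\<close>. Projective parameters are related by
  fractional linear transformations, which in general are defined only on part of \<open>I\<close>.
\<close>

definition reparametrization ::
    "('a::euclidean_space \<Rightarrow> 'a \<Rightarrow> real) \<Rightarrow> 'a set set \<Rightarrow> real set \<Rightarrow> (real \<Rightarrow> 'a set) \<Rightarrow> bool" where
  "reparametrization \<omega> S J \<Gamma> \<longleftrightarrow>
     open_interval J \<and>
     (\<exists>I \<gamma> \<phi>. injective_jacobi_curve_onto \<omega> S I \<gamma> \<and>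
        \<phi> ` J \<subseteq> I \<and> smooth_on J \<phi> \<and> (\<forall>t\<in>J. vector_derivative \<phi> (at t) \<noteq> 0) \<and>
        (\<forall>t\<in>J. \<Gamma> t = \<gamma> (\<phi> t)))"


section \<open>Curvature\<close>

text \<open>
  \<open>chart_deriv \<Gamma> \<tau> \<Delta> k\<close> is the \<open>k\<close>-th derivative at \<open>\<tau>\<close> of \<open>\<Gamma>\<close>, seen near \<open>\<tau>\<close> as a curve in
  the affine space of transversals of \<open>\<Delta>\<close> with origin \<open>\<Gamma> \<tau>\<close>.
\<close>

definition chart_deriv ::
    "(real \<Rightarrow> 'a::euclidean_space set) \<Rightarrow> real \<Rightarrow> 'a set \<Rightarrow> nat \<Rightarrow> ('a \<Rightarrow>\<^sub>L 'a)" where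
  "chart_deriv \<Gamma> \<tau> \<Delta> k = nth_deriv k (\<lambda>t. graph_chart (\<Gamma> \<tau>) \<Delta> (\<Gamma> t)) \<tau>"

definition derivative_lagrangian ::
    "('a::euclidean_space \<Rightarrow> 'a \<Rightarrow> real) \<Rightarrow> (real \<Rightarrow> 'a set) \<Rightarrow> real \<Rightarrow> 'a set" where
  "derivative_lagrangian \<omega> \<Gamma> \<tau> =
     (THE \<Delta>. \<Delta> \<in> transversals \<omega> (\<Gamma> \<tau>) \<and> chart_deriv \<Gamma> \<tau> \<Delta> 2 = 0)"

text \<open>Only the values on \<open>\<Gamma> \<tau>\<close> are meaningful.\<close>

definition curvature_operator ::
    "('a::euclidean_space \<Rightarrow> 'a \<Rightarrow> real) \<Rightarrow> (real \<Rightarrow> 'a set) \<Rightarrow> real \<Rightarrow> 'a \<Rightarrow> 'a" where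
  "curvature_operator \<omega> \<Gamma> \<tau> v =
     (let \<Delta> = derivative_lagrangian \<omega> \<Gamma> \<tau> in
        inv_into (\<Gamma> \<tau>) (blinfun_apply (chart_deriv \<Gamma> \<tau> \<Delta> 1))
          (blinfun_apply (chart_deriv \<Gamma> \<tau> \<Delta> 3) v))"

definition trace_on :: "'a::real_vector set \<Rightarrow> ('a \<Rightarrow> 'a) \<Rightarrow> real" where
  "trace_on S f =
     (let B = (SOME B. independent B \<and> span B = S) in \<Sum>b\<in>B. representation B (f b) b)"

definition projective ::
    "('a::euclidean_space \<Rightarrow> 'a \<Rightarrow> real) \<Rightarrow> real set \<Rightarrow> (real \<Rightarrow> 'a set) \<Rightarrow> bool" where
  "projective \<omega> J \<Gamma> \<longleftrightarrow> (\<forall>t\<in>J. trace_on (\<Gamma> t) (curvature_operator \<omega> \<Gamma> t) = 0)"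

end

theory Submission
  imports Defs
begin

text \<open>
  In homogeneous coordinates the cycle is \<open>{a u + b B u | u \<in> \<Gamma>\<^sub>0}\<close>, \<open>[a : b] \<in> RP\<^sup>1\<close>, with \<open>B\<close> an
  isomorphism from \<open>\<Gamma>\<^sub>0\<close> onto \<open>\<Delta>\<close>, so that no point is distinguished and removing any point leaves an
  affine line \<open>{u + x B u}\<close>. A reparametrization replaces \<open>x\<close> by a scalar function \<open>h(t)\<close> with \<open>h' \<noteq> 0\<close>,
  where we may take \<open>h(\<tau>) = 0\<close>. If \<open>P\<close> is the projection onto \<open>\<Gamma>\<^sub>0\<close> along a transversal \<open>D\<close>, then in
  the chart of \<open>D\<close> the curve is \<open>h N (1 + h K)\<^sup>-\<^sup>1\<close> with \<open>N = (1 - P) B P\<close> and \<open>K = P B P\<close>. Its second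
  derivative \<open>h'' N - 2 h'\<^sup>2 N K\<close> vanishes only for \<open>D = {B u + \<lambda> u}\<close> with \<open>\<lambda> = - h'' / (2 h'\<^sup>2)\<close>, and in
  that chart the curve is \<open>h / (1 - \<lambda> h)\<close> times \<open>N\<close>. Hence the curvature operator is a scalar, which
  vanishes with its trace.
\<close>

section \<open>Calculus of smooth curves\<close>

text \<open>Finite-order form of \<open>smooth_on\<close>, so that closure under sums, products,
  inverses and composition can be proved by induction on the order.\<close>

definition ndiff_on :: "nat \<Rightarrow> real set \<Rightarrow> (real \<Rightarrow> 'b::real_normed_vector) \<Rightarrow> bool" where
  "ndiff_on k U f \<longleftrightarrow> (\<forall>j<k. \<forall>t\<in>U. nth_deriv j f differentiable (at t))"

lemma nth_deriv_0 [simp]: "nth_deriv 0 f = f"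
  by (simp add: nth_deriv_def)

text \<open>Splitting off the derivative that is taken first lets an induction on the order replace
  the function by its derivative.\<close>

lemma nth_deriv_Suc: "nth_deriv (Suc k) f = nth_deriv k (\<lambda>t. vector_derivative f (at t))"
  by (simp add: nth_deriv_def funpow_Suc_right del: funpow.simps)

lemma vector_derivative_cong_open:
  assumes "open U" "\<And>t. t \<in> U \<Longrightarrow> f t = g t" "t \<in> U"
  shows "vector_derivative f (at t) = vector_derivative g (at t)"
proof (rule vector_derivative_cong_eq)
  show "eventually (\<lambda>x. x \<in> UNIV \<longrightarrow> f x = g x) (nhds t)"
    using eventually_nhds assms by blast
qed (use assms in auto)

lemma nth_deriv_cong_open:
  assumes "open U" "\<And>t. t \<in> U \<Longrightarrow> f t = g t" "t \<in> U"
  shows "nth_deriv k f t = nth_deriv k g t"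
  using assms
proof (induction k arbitrary: f g t)
  case (Suc k)
  show ?case unfolding nth_deriv_Suc
    using Suc.prems by (intro Suc.IH) (auto intro: vector_derivative_cong_open)
qed simp

lemma smooth_on_iff_ndiff_on: "smooth_on U f \<longleftrightarrow> (\<forall>k. ndiff_on k U f)"
  unfolding smooth_on_def ndiff_on_def by blast

lemma ndiff_on_0 [simp]: "ndiff_on 0 U f"
  by (simp add: ndiff_on_def)

lemma ndiff_on_Suc:
  "ndiff_on (Suc k) U f \<longleftrightarrow>
     (\<forall>t\<in>U. f differentiable (at t)) \<and> ndiff_on k U (\<lambda>t. vector_derivative f (at t))"
  unfolding ndiff_on_def All_less_Suc2 by (simp add: nth_deriv_Suc)

lemma ndiff_on_SucD: "ndiff_on (Suc k) U f \<Longrightarrow> ndiff_on k U f"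
  unfolding ndiff_on_def by auto

lemma ndiff_on_Suc_has_vector_derivative:
  assumes "ndiff_on (Suc k) U f" "t \<in> U"
  shows "(f has_vector_derivative vector_derivative f (at t)) (at t)"
  using assms by (simp add: ndiff_on_Suc vector_derivative_works)

lemma differentiable_cong_open:
  assumes "open U" "\<And>t. t \<in> U \<Longrightarrow> f t = g t" "t \<in> U" "g differentiable (at t)"
  shows "f differentiable (at t)"
proof -
  obtain D where "(g has_derivative D) (at t)"
    using assms(4) unfolding differentiable_def by blast
  then have "(f has_derivative D) (at t)"
    by (rule has_derivative_transform_within_open) (use assms in auto)
  then show ?thesis unfolding differentiable_def by blast
qed

lemma ndiff_on_cong_open:
  assumes "open U" "\<And>t. t \<in> U \<Longrightarrow> f t = g t" "ndiff_on k U g"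
  shows "ndiff_on k U f"
  unfolding ndiff_on_def
proof (intro allI impI ballI)
  fix j t assume "j < k" "t \<in> U"
  then have "nth_deriv j g differentiable (at t)"
    using assms(3) by (auto simp: ndiff_on_def)
  moreover have "nth_deriv j f s = nth_deriv j g s" if "s \<in> U" for s
    using assms(1,2) that by (rule nth_deriv_cong_open)
  ultimately show "nth_deriv j f differentiable (at t)"
    using differentiable_cong_open[OF assms(1)] \<open>t \<in> U\<close> by metis
qed

text \<open>The candidate \<open>f'\<close> has to be the derivative only on the open set
  \<open>U\<close>, so explicit formulas can be used that may fail elsewhere.\<close>

lemma ndiff_on_SucI:
  assumes "open U" "\<And>t. t \<in> U \<Longrightarrow> (f has_vector_derivative f' t) (at t)" "ndiff_on k U f'"
  shows "ndiff_on (Suc k) U f"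
  unfolding ndiff_on_Suc
proof
  show "\<forall>t\<in>U. f differentiable (at t)"
    using assms(2) differentiableI_vector by blast
  show "ndiff_on k U (\<lambda>t. vector_derivative f (at t))"
    using assms(1) _ assms(3) by (rule ndiff_on_cong_open) (use assms(2) vector_derivative_at in blast)
qed

section \<open>Differentiation rules at finite order\<close>

lemma ndiff_on_const: "open U \<Longrightarrow> ndiff_on k U (\<lambda>t. c)"
proof (induction k arbitrary: c)
  case (Suc k)
  then show ?case by (intro ndiff_on_SucI[where f' = "\<lambda>t. 0"]) auto
qed simp

lemma ndiff_on_ident: "open U \<Longrightarrow> ndiff_on k U (\<lambda>t. t)"
proof (cases k)
  case (Suc j)
  assume "open U"
  then show ?thesis unfolding Suc
    by (intro ndiff_on_SucI[where f' = "\<lambda>t. 1"] ndiff_on_const) auto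
qed simp

lemma ndiff_on_add:
  "open U \<Longrightarrow> ndiff_on k U f \<Longrightarrow> ndiff_on k U g \<Longrightarrow> ndiff_on k U (\<lambda>t. f t + g t)"
proof (induction k arbitrary: f g)
  case (Suc k)
  show ?case
  proof (rule ndiff_on_SucI)
    fix t assume t: "t \<in> U"
    show "((\<lambda>t. f t + g t) has_vector_derivative
        vector_derivative f (at t) + vector_derivative g (at t)) (at t)"
      using Suc.prems(2,3)[THEN ndiff_on_Suc_has_vector_derivative, OF t]
      by (rule has_vector_derivative_add)
  qed (use Suc in \<open>auto simp: ndiff_on_Suc\<close>)
qed simp

lemma (in bounded_linear) ndiff_on:
  assumes "open U" "ndiff_on k U g"
  shows "ndiff_on k U (\<lambda>t. f (g t))"
  using assms(2)
proof (induction k arbitrary: g)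
  case (Suc k)
  show ?case
  proof (rule ndiff_on_SucI[OF assms(1)])
    fix t assume t: "t \<in> U"
    show "((\<lambda>t. f (g t)) has_vector_derivative f (vector_derivative g (at t))) (at t)"
      using Suc.prems[THEN ndiff_on_Suc_has_vector_derivative, OF t] by (rule has_vector_derivative)
  qed (use Suc in \<open>auto simp: ndiff_on_Suc\<close>)
qed simp

text \<open>The product rule leads to the pairs \<open>(f, g')\<close> and \<open>(f', g)\<close>,
  so the induction generalizes over both functions.\<close>

lemma (in bounded_bilinear) ndiff_on:
  assumes "open U" "ndiff_on k U f" "ndiff_on k U g"
  shows "ndiff_on k U (\<lambda>t. prod (f t) (g t))"
  using assms(2,3)
proof (induction k arbitrary: f g)
  case (Suc k)
  show ?case
  proof (rule ndiff_on_SucI[OF assms(1)])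
    fix t assume t: "t \<in> U"
    show "((\<lambda>t. prod (f t) (g t)) has_vector_derivative
        prod (f t) (vector_derivative g (at t)) + prod (vector_derivative f (at t)) (g t)) (at t)"
      using Suc.prems[THEN ndiff_on_Suc_has_vector_derivative, OF t] by (rule has_vector_derivative)
  next
    have "ndiff_on k U f" "ndiff_on k U g"
      "ndiff_on k U (\<lambda>t. vector_derivative f (at t))" "ndiff_on k U (\<lambda>t. vector_derivative g (at t))"
      using Suc.prems[THEN ndiff_on_SucD] Suc.prems by (auto simp: ndiff_on_Suc)
    then show "ndiff_on k U (\<lambda>t. prod (f t) (vector_derivative g (at t)) +
        prod (vector_derivative f (at t)) (g t))"
      by (intro ndiff_on_add assms(1) Suc.IH)
  qed
qed simp

text \<open>The derivative \<open>- (1/f) f' (1/f)\<close> contains \<open>1/f\<close> itself but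
  none of its derivatives, so the induction hypothesis for the same \<open>f\<close>
  suffices.\<close>

lemma ndiff_on_inverse:
  fixes f :: "real \<Rightarrow> real"
  assumes "open U" "ndiff_on k U f" "\<And>t. t \<in> U \<Longrightarrow> f t \<noteq> 0"
  shows "ndiff_on k U (\<lambda>t. inverse (f t))"
  using assms(2)
proof (induction k)
  case (Suc k)
  let ?f' = "\<lambda>t. vector_derivative f (at t)"
  have IH: "ndiff_on k U (\<lambda>t. inverse (f t))"
    using Suc ndiff_on_SucD by blast
  show ?case
  proof (rule ndiff_on_SucI[OF assms(1)])
    fix t assume t: "t \<in> U"
    have "(f has_field_derivative ?f' t) (at t)"
      using ndiff_on_Suc_has_vector_derivative[OF Suc.prems t]
      by (simp add: has_real_derivative_iff_has_vector_derivative)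
    then have "((\<lambda>t. inverse (f t)) has_field_derivative
        - (inverse (f t) * ?f' t * inverse (f t))) (at t)"
      using assms(3)[OF t] by (rule DERIV_inverse')
    then show "((\<lambda>t. inverse (f t)) has_vector_derivative
        - (inverse (f t) * ?f' t * inverse (f t))) (at t)"
      by (simp add: has_real_derivative_iff_has_vector_derivative)
  next
    show "ndiff_on k U (\<lambda>t. - (inverse (f t) * ?f' t * inverse (f t)))"
      using Suc.prems IH unfolding ndiff_on_Suc
      by (intro bounded_linear.ndiff_on[OF bounded_linear_minus[OF bounded_linear_ident]]
          bounded_bilinear.ndiff_on[OF bounded_bilinear_mult] assms(1)) blast+
  qed
qed simp

text \<open>The chain rule replaces \<open>f\<close> by \<open>f'\<close> and keeps the inner
  function, so the induction generalizes over \<open>f\<close> only.\<close>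

lemma ndiff_on_compose:
  fixes g :: "real \<Rightarrow> real"
  assumes "open U" "open V" "g ` U \<subseteq> V" "ndiff_on k V f" "ndiff_on k U g"
  shows "ndiff_on k U (\<lambda>t. f (g t))"
  using assms(4,5)
proof (induction k arbitrary: f)
  case (Suc k)
  let ?f' = "\<lambda>t. vector_derivative f (at t)" and ?g' = "\<lambda>t. vector_derivative g (at t)"
  show ?case
  proof (rule ndiff_on_SucI[OF assms(1)])
    fix t assume t: "t \<in> U"
    then have "g t \<in> V" using assms(3) by auto
    have "((f \<circ> g) has_vector_derivative ?g' t *\<^sub>R ?f' (g t)) (at t)"
      using ndiff_on_Suc_has_vector_derivative[OF Suc.prems(2) t]
        ndiff_on_Suc_has_vector_derivative[OF Suc.prems(1) \<open>g t \<in> V\<close>]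
      by (rule vector_diff_chain_at)
    then show "((\<lambda>t. f (g t)) has_vector_derivative ?g' t *\<^sub>R ?f' (g t)) (at t)"
      by (simp add: o_def)
  next
    have "ndiff_on k U ?g'" "ndiff_on k V ?f'"
      using Suc.prems by (auto simp: ndiff_on_Suc)
    then show "ndiff_on k U (\<lambda>t. ?g' t *\<^sub>R ?f' (g t))"
      using ndiff_on_SucD[OF Suc.prems(2)]
      by (intro bounded_bilinear.ndiff_on[OF bounded_bilinear_scaleR] assms(1) Suc.IH)
  qed
qed simp

section \<open>The same rules for smooth functions\<close>

lemma smooth_on_cong_open:
  "open U \<Longrightarrow> (\<And>t. t \<in> U \<Longrightarrow> f t = g t) \<Longrightarrow> smooth_on U g \<Longrightarrow> smooth_on U f"
  using ndiff_on_cong_open unfolding smooth_on_iff_ndiff_on by blast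

lemma smooth_on_subset: "smooth_on U f \<Longrightarrow> V \<subseteq> U \<Longrightarrow> smooth_on V f"
  unfolding smooth_on_def by blast

lemma smooth_on_const: "open U \<Longrightarrow> smooth_on U (\<lambda>t. c)"
  by (simp add: smooth_on_iff_ndiff_on ndiff_on_const)

lemma smooth_on_ident: "open U \<Longrightarrow> smooth_on U (\<lambda>t. t)"
  by (simp add: smooth_on_iff_ndiff_on ndiff_on_ident)

lemma smooth_on_add:
  "open U \<Longrightarrow> smooth_on U f \<Longrightarrow> smooth_on U g \<Longrightarrow> smooth_on U (\<lambda>t. f t + g t)"
  by (simp add: smooth_on_iff_ndiff_on ndiff_on_add)

lemma (in bounded_linear) smooth_on:
  "open U \<Longrightarrow> smooth_on U g \<Longrightarrow> smooth_on U (\<lambda>t. f (g t))"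
  by (simp add: smooth_on_iff_ndiff_on ndiff_on)

lemma (in bounded_bilinear) smooth_on:
  "open U \<Longrightarrow> smooth_on U f \<Longrightarrow> smooth_on U g \<Longrightarrow> smooth_on U (\<lambda>t. prod (f t) (g t))"
  by (simp add: smooth_on_iff_ndiff_on ndiff_on)

lemma smooth_on_divide:
  fixes f g :: "real \<Rightarrow> real"
  assumes "open U" "smooth_on U f" "smooth_on U g" "\<And>t. t \<in> U \<Longrightarrow> g t \<noteq> 0"
  shows "smooth_on U (\<lambda>t. f t / g t)"
  unfolding divide_inverse
proof (rule bounded_bilinear.smooth_on[OF bounded_bilinear_mult])
  show "smooth_on U (\<lambda>t. inverse (g t))"
    using assms by (simp add: smooth_on_iff_ndiff_on ndiff_on_inverse)
qed (use assms in auto)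

lemma smooth_on_compose:
  fixes g :: "real \<Rightarrow> real"
  shows "open U \<Longrightarrow> open V \<Longrightarrow> g ` U \<subseteq> V \<Longrightarrow> smooth_on V f \<Longrightarrow> smooth_on U g \<Longrightarrow> smooth_on U (\<lambda>t. f (g t))"
  by (simp add: smooth_on_iff_ndiff_on ndiff_on_compose)

lemma smooth_on_has_vector_derivative:
  "smooth_on U f \<Longrightarrow> t \<in> U \<Longrightarrow> (f has_vector_derivative vector_derivative f (at t)) (at t)"
  using ndiff_on_Suc_has_vector_derivative unfolding smooth_on_iff_ndiff_on by blast

lemma smooth_on_vector_derivative:
  "smooth_on U f \<Longrightarrow> smooth_on U (\<lambda>t. vector_derivative f (at t))"
  unfolding smooth_on_iff_ndiff_on by (metis ndiff_on_Suc)

lemma smooth_on_continuous_on: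
  assumes "smooth_on U f"
  shows "continuous_on U f"
  by (intro continuous_at_imp_continuous_on ballI has_vector_derivative_continuous)
    (rule smooth_on_has_vector_derivative[OF assms])

text \<open>Reduces the derivatives of a chart in which the curve moves along a fixed map to
  derivatives of a real function.\<close>

lemma nth_deriv_scaleR_const:
  fixes m :: "real \<Rightarrow> real"
  assumes "open U" "smooth_on U m" "t \<in> U"
  shows "nth_deriv k (\<lambda>t. m t *\<^sub>R c) t = nth_deriv k m t *\<^sub>R c"
  using assms(2,3)
proof (induction k arbitrary: m t)
  case (Suc k)
  let ?m' = "\<lambda>t. vector_derivative m (at t)"
  have "nth_deriv k (\<lambda>t. vector_derivative (\<lambda>t. m t *\<^sub>R c) (at t)) t
      = nth_deriv k (\<lambda>t. ?m' t *\<^sub>R c) t"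
    using assms(1) _ Suc.prems(2)
  proof (rule nth_deriv_cong_open)
    fix s assume "s \<in> U"
    show "vector_derivative (\<lambda>t. m t *\<^sub>R c) (at s) = ?m' s *\<^sub>R c"
      using bounded_linear.has_vector_derivative[OF bounded_linear_scaleR_left
        smooth_on_has_vector_derivative[OF Suc.prems(1) \<open>s \<in> U\<close>]]
      by (rule vector_derivative_at)
  qed
  also have "\<dots> = nth_deriv k ?m' t *\<^sub>R c"
    using Suc smooth_on_vector_derivative by blast
  finally show ?case by (simp add: nth_deriv_Suc)
qed simp

section \<open>Transversal Lagrangian subspaces and graph charts\<close>

text \<open>The dimension formula makes the sum of \<open>S\<close> and \<open>T\<close> the whole
  space, and the trivial intersection makes the decomposition of a vector unique. Uniqueness then
  gives linearity.\<close>

lemma complementary_projection: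
  fixes S T :: "'a::euclidean_space set"
  assumes "subspace S" "subspace T" "S \<inter> T = {0}" "dim S + dim T = DIM('a)"
  obtains P :: "'a \<Rightarrow>\<^sub>L 'a"
  where "\<And>w. P w \<in> S" "\<And>w. w - P w \<in> T"
    "\<And>w. w \<in> S \<Longrightarrow> P w = w" "\<And>w. w \<in> T \<Longrightarrow> P w = 0"
proof -
  have "dim {x + y |x y. x \<in> S \<and> y \<in> T} = DIM('a)"
    using dim_sums_Int[OF assms(1,2)] assms(3,4) by simp
  then have "span {x + y |x y. x \<in> S \<and> y \<in> T} = UNIV"
    by (simp add: dim_eq_full)
  then have sums: "{x + y |x y. x \<in> S \<and> y \<in> T} = UNIV"
    using span_eq_iff[THEN iffD2, OF subspace_sums[OF assms(1,2)]] by simp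
  have "\<exists>p. p \<in> S \<and> w - p \<in> T" for w
  proof -
    have "w \<in> {x + y |x y. x \<in> S \<and> y \<in> T}" using sums by simp
    then obtain x y where "w = x + y" "x \<in> S" "y \<in> T" by blast
    then show ?thesis by (intro exI[of _ x]) simp
  qed
  then obtain p where p: "p w \<in> S" "w - p w \<in> T" for w by metis
  have uniq: "a = b" if "a \<in> S" "b \<in> S" "w - a \<in> T" "w - b \<in> T" for a b w
  proof -
    have "a - b \<in> S" "a - b \<in> T"
      using subspace_diff[OF assms(1) that(1,2)] subspace_diff[OF assms(2) that(4,3)] by auto
    then have "a - b \<in> {0}" using assms(3) by blast
    then show ?thesis by simp
  qed
  have "linear p"
  proof
    fix a b
    have "a + b - (p a + p b) = (a - p a) + (b - p b)" by simp
    then have "a + b - (p a + p b) \<in> T"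
      using subspace_add[OF assms(2) p(2) p(2), of a b] by (simp only:)
    then show "p (a + b) = p a + p b"
      using uniq[OF p(1) subspace_add[OF assms(1) p(1) p(1)] p(2)] by blast
  next
    fix r a
    have "r *\<^sub>R a - r *\<^sub>R p a = r *\<^sub>R (a - p a)" by (simp add: scaleR_diff_right)
    then have "r *\<^sub>R a - r *\<^sub>R p a \<in> T"
      using subspace_scale[OF assms(2) p(2), of r a] by (simp only:)
    then show "p (r *\<^sub>R a) = r *\<^sub>R p a"
      using uniq[OF p(1) subspace_scale[OF assms(1) p(1)] p(2)] by blast
  qed
  then have "blinfun_apply (Blinfun p) = p"
    by (simp add: bounded_linear_Blinfun_apply linear_conv_bounded_linear)
  moreover have "p w = w" if "w \<in> S" for w
    using that p assms(2) by (intro uniq[of _ _ w]) (auto simp: subspace_0)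
  moreover have "p w = 0" if "w \<in> T" for w
    using that p assms(1) by (intro uniq[of _ _ w]) (auto simp: subspace_0)
  ultimately show ?thesis
    using that[of "Blinfun p"] p by simp
qed

lemma lagrangianD:
  fixes \<omega> :: "'a::euclidean_space \<Rightarrow> 'a \<Rightarrow> real"
  assumes "\<Lambda> \<in> lagrangian_grassmannian \<omega>"
  shows "subspace \<Lambda>" "\<And>u v. u \<in> \<Lambda> \<Longrightarrow> v \<in> \<Lambda> \<Longrightarrow> \<omega> u v = 0"
    "2 * dim \<Lambda> = DIM('a)"
  using assms by (auto simp: lagrangian_grassmannian_def)

lemma transversalsD:
  assumes "\<Gamma> \<in> transversals \<omega> \<Delta>"
  shows "\<Gamma> \<in> lagrangian_grassmannian \<omega>" "\<Gamma> \<inter> \<Delta> = {0}"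
  using assms by (auto simp: transversals_def)

lemma lagrangian_projection:
  fixes \<omega> :: "'a::euclidean_space \<Rightarrow> 'a \<Rightarrow> real"
  assumes "\<Gamma> \<in> lagrangian_grassmannian \<omega>" "\<Delta> \<in> lagrangian_grassmannian \<omega>" "\<Gamma> \<inter> \<Delta> = {0}"
  obtains P :: "'a \<Rightarrow>\<^sub>L 'a"
  where "\<And>w. P w \<in> \<Gamma>" "\<And>w. w - P w \<in> \<Delta>"
    "\<And>w. w \<in> \<Gamma> \<Longrightarrow> P w = w" "\<And>w. w \<in> \<Delta> \<Longrightarrow> P w = 0"
proof -
  have "dim \<Gamma> + dim \<Delta> = DIM('a)"
    using assms(1,2)[THEN lagrangianD(3)] by linarith
  from complementary_projection[OF assms(1,2)[THEN lagrangianD(1)] assms(3) this] that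
  show ?thesis .
qed

section \<open>Graphs of linear maps as charts\<close>

lemma lin_mapsD:
  assumes "A \<in> lin_maps \<Delta>"
  shows "blinfun_apply A w \<in> \<Delta>" "w \<in> \<Delta> \<Longrightarrow> blinfun_apply A w = 0"
  using assms by (auto simp: lin_maps_def)

text \<open>Projecting \<open>u + A u\<close> along \<Delta> recovers \<open>u\<close>, so the graph
  determines the map on \<open>\<Gamma>\<^sub>0\<close>; on \<Delta> both maps vanish.\<close>

lemma graph_over_inject:
  fixes \<omega> :: "'a::euclidean_space \<Rightarrow> 'a \<Rightarrow> real"
  assumes "\<Gamma>\<^sub>0 \<in> lagrangian_grassmannian \<omega>" "\<Delta> \<in> lagrangian_grassmannian \<omega>" "\<Gamma>\<^sub>0 \<inter> \<Delta> = {0}"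
    and A: "A \<in> lin_maps \<Delta>" and B: "B \<in> lin_maps \<Delta>"
    and eq: "graph_over \<Gamma>\<^sub>0 A = graph_over \<Gamma>\<^sub>0 B"
  shows "A = B"
proof (rule blinfun_eqI)
  obtain P where P: "\<And>w. blinfun_apply P w \<in> \<Gamma>\<^sub>0" "\<And>w. w - P w \<in> \<Delta>"
    "\<And>w. w \<in> \<Gamma>\<^sub>0 \<Longrightarrow> P w = w" "\<And>w. w \<in> \<Delta> \<Longrightarrow> P w = 0"
    by (rule lagrangian_projection[OF assms(1-3)]) (rule that)
  have on: "A u = B u" if "u \<in> \<Gamma>\<^sub>0" for u
  proof -
    have "u + A u \<in> graph_over \<Gamma>\<^sub>0 B"
      using that eq unfolding graph_over_def by blast
    then obtain u' where u': "u' \<in> \<Gamma>\<^sub>0" "u + A u = u' + B u'"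
      unfolding graph_over_def by blast
    have "P (u + A u) = P (u' + B u')" using u'(2) by simp
    then have "u = u'"
      using P(3,4) that u'(1) lin_mapsD(1)[OF A] lin_mapsD(1)[OF B]
      by (simp add: blinfun.add_right)
    then show ?thesis using u'(2) by simp
  qed
  fix w
  have "A w = A (P w) + A (w - P w)" "B w = B (P w) + B (w - P w)"
    by (simp_all add: blinfun.diff_right)
  then show "A w = B w"
    using on P lin_mapsD(2)[OF A] lin_mapsD(2)[OF B] by simp
qed

lemma graph_chart_graph_over:
  fixes \<omega> :: "'a::euclidean_space \<Rightarrow> 'a \<Rightarrow> real"
  assumes "\<Gamma>\<^sub>0 \<in> lagrangian_grassmannian \<omega>" "\<Delta> \<in> lagrangian_grassmannian \<omega>" "\<Gamma>\<^sub>0 \<inter> \<Delta> = {0}"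
    and "A \<in> lin_maps \<Delta>"
  shows "graph_chart \<Gamma>\<^sub>0 \<Delta> (graph_over \<Gamma>\<^sub>0 A) = A"
  unfolding graph_chart_def
  using assms graph_over_inject[OF assms(1-3)] by (intro the_equality) auto

text \<open>If \<open>P\<close> and \<open>Q\<close> project along \<Delta> onto
  \<open>\<Gamma>\<^sub>0\<close> and \<Gamma>, then \<Gamma> is the graph of \<open>Q - P\<close>:
  this map kills \<Delta>, takes values in \<Delta>, and \<open>u + (Q - P) u = Q u\<close> for
  \<open>u\<close> in \<open>\<Gamma>\<^sub>0\<close>.\<close>

lemma graph_chart_works:
  fixes \<omega> :: "'a::euclidean_space \<Rightarrow> 'a \<Rightarrow> real"
  assumes "\<Delta> \<in> lagrangian_grassmannian \<omega>" "\<Gamma>\<^sub>0 \<in> transversals \<omega> \<Delta>" "\<Gamma> \<in> transversals \<omega> \<Delta>"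
  shows "graph_chart \<Gamma>\<^sub>0 \<Delta> \<Gamma> \<in> lin_maps \<Delta>" "graph_over \<Gamma>\<^sub>0 (graph_chart \<Gamma>\<^sub>0 \<Delta> \<Gamma>) = \<Gamma>"
proof -
  obtain P where P: "\<And>w. blinfun_apply P w \<in> \<Gamma>\<^sub>0" "\<And>w. w - P w \<in> \<Delta>"
    "\<And>w. w \<in> \<Gamma>\<^sub>0 \<Longrightarrow> P w = w" "\<And>w. w \<in> \<Delta> \<Longrightarrow> P w = 0"
    by (rule lagrangian_projection[OF transversalsD(1)[OF assms(2)] assms(1) transversalsD(2)[OF assms(2)]])
      (rule that)
  obtain Q where Q: "\<And>w. blinfun_apply Q w \<in> \<Gamma>" "\<And>w. w - Q w \<in> \<Delta>"
    "\<And>w. w \<in> \<Gamma> \<Longrightarrow> Q w = w" "\<And>w. w \<in> \<Delta> \<Longrightarrow> Q w = 0"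
    by (rule lagrangian_projection[OF transversalsD(1)[OF assms(3)] assms(1) transversalsD(2)[OF assms(3)]])
      (rule that)
  have "(w - P w) - (w - Q w) \<in> \<Delta>" for w
    using P(2) Q(2) lagrangianD(1)[OF assms(1)] subspace_diff by blast
  then have lin: "Q - P \<in> lin_maps \<Delta>"
    using P(4) Q(4) by (simp add: lin_maps_def blinfun.diff_left)
  have "graph_over \<Gamma>\<^sub>0 (Q - P) = Q ` \<Gamma>\<^sub>0"
    unfolding graph_over_def using P(3) by (intro image_cong) (auto simp: blinfun.diff_left)
  also have "\<dots> = \<Gamma>"
  proof
    show "\<Gamma> \<subseteq> Q ` \<Gamma>\<^sub>0"
    proof
      fix v assume "v \<in> \<Gamma>"
      have "Q v = Q (P v) + Q (v - P v)" by (simp add: blinfun.diff_right)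
      then have "v = Q (P v)" using P(2) Q(3,4) \<open>v \<in> \<Gamma>\<close> by simp
      then show "v \<in> Q ` \<Gamma>\<^sub>0" using P(1) by blast
    qed
  qed (use Q(1) in auto)
  finally have graph: "graph_over \<Gamma>\<^sub>0 (Q - P) = \<Gamma>" .
  then have "graph_chart \<Gamma>\<^sub>0 \<Delta> \<Gamma> = Q - P"
    using graph_chart_graph_over[OF transversalsD(1)[OF assms(2)] assms(1) transversalsD(2)[OF assms(2)] lin]
    by simp
  then show "graph_chart \<Gamma>\<^sub>0 \<Delta> \<Gamma> \<in> lin_maps \<Delta>" "graph_over \<Gamma>\<^sub>0 (graph_chart \<Gamma>\<^sub>0 \<Delta> \<Gamma>) = \<Gamma>"
    using lin graph by simp_all
qed

lemma lagrangian_nonzero: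
  fixes \<omega> :: "'a::euclidean_space \<Rightarrow> 'a \<Rightarrow> real"
  assumes "\<Lambda> \<in> lagrangian_grassmannian \<omega>"
  obtains u where "u \<in> \<Lambda>" "u \<noteq> 0"
proof -
  have "dim \<Lambda> \<noteq> 0" using lagrangianD(3)[OF assms] DIM_positive[where 'a='a] by linarith
  then have "\<not> \<Lambda> \<subseteq> {0}" by simp
  then show ?thesis using that by blast
qed

text \<open>Whatever basis is chosen, each of its vectors contributes the diagonal entry
  \<open>c\<close>. Only the values of \<open>f\<close> on \<open>S\<close> enter.\<close>

lemma trace_on_scaleR:
  fixes S :: "'a::euclidean_space set"
  assumes "subspace S" "\<And>v. v \<in> S \<Longrightarrow> f v = c *\<^sub>R v"
  shows "trace_on S f = c * real (dim S)"
proof -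
  define B where "B = (SOME B. independent B \<and> span B = S)"
  have "\<exists>B. independent B \<and> span B = S"
    by (rule basis_exists[of S]) (use assms(1) span_subspace in blast)
  then have B: "independent B" "span B = S"
    unfolding B_def by (metis (mono_tags, lifting) someI_ex)+
  have "representation B (f b) b = c" if "b \<in> B" for b
  proof -
    have "b \<in> span B" using that by (rule span_base)
    then show ?thesis
      using assms(2) B that by (simp add: representation_scale representation_basis)
  qed
  then have "trace_on S f = real (card B) * c"
    unfolding trace_on_def Let_def B_def[symmetric] by simp
  also have "card B = dim S"
    using dim_eq_card_independent[OF B(1)] dim_span[of B] B(2) by simp
  finally show ?thesis by simp
qed

text \<open>The resolvent identity \<open>Y z - Y x = (x - z) (Y z) K (Y x)\<close> makes \<open>Y\<close> Lipschitz and then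
  differentiable.\<close>

lemma resolvent_has_vector_derivative:
  fixes K :: "'a::euclidean_space \<Rightarrow>\<^sub>L 'a"
  obtains r Y where "r > 0"
    "\<And>x w. \<bar>x\<bar> < r \<Longrightarrow> blinfun_apply (Y x) (w + x *\<^sub>R K w) = w"
    "\<And>x w. \<bar>x\<bar> < r \<Longrightarrow> Y x w + x *\<^sub>R K (Y x w) = w"
    "\<And>x. \<bar>x\<bar> < r \<Longrightarrow> (Y has_vector_derivative - (Y x o\<^sub>L K o\<^sub>L Y x)) (at x)"
proof -
  \<comment> \<open>This radius forces \<open>\<bar>x\<bar> * norm K \<le> 1 / 2\<close>, so that
    \<open>1 + x K\<close> shrinks norms by at most a factor 2. The summand 1 keeps the denominator
    positive if \<open>K = 0\<close>.\<close>
  define r where "r = 1 / (2 * (norm K + 1))"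
  have r: "r > 0" by (simp add: r_def add_nonneg_pos)
  have expand: "norm w \<le> 2 * norm (w + x *\<^sub>R K w)" if "\<bar>x\<bar> < r" for x w
  proof -
    have "\<bar>x\<bar> * norm K \<le> r * norm K"
      using that by (intro mult_right_mono) auto
    also have "\<dots> \<le> 1 / 2"
      by (simp add: r_def divide_simps add_nonneg_pos)
    finally have "\<bar>x\<bar> * norm K \<le> 1 / 2" .
    have "norm (x *\<^sub>R K w) \<le> \<bar>x\<bar> * (norm K * norm w)"
      by (simp add: norm_blinfun mult_left_mono)
    also have "\<dots> \<le> 1 / 2 * norm w"
      using mult_right_mono[OF \<open>\<bar>x\<bar> * norm K \<le> 1 / 2\<close>, of "norm w"] by (simp add: mult.assoc)
    finally show ?thesis
      using norm_diff_ineq[of w "x *\<^sub>R K w"] by linarith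
  qed
  have "\<exists>Z::'a \<Rightarrow>\<^sub>L 'a. (\<forall>w. Z (w + x *\<^sub>R K w) = w) \<and> (\<forall>w. Z w + x *\<^sub>R K (Z w) = w)"
    if "\<bar>x\<bar> < r" for x
  proof -
    have lin: "linear (\<lambda>w. w + x *\<^sub>R K w)"
      by (intro linearI) (simp_all add: blinfun.bilinear_simps algebra_simps)
    moreover have "inj (\<lambda>w. w + x *\<^sub>R K w)"
      unfolding linear_injective_0[OF lin]
    proof (intro allI impI)
      fix w assume "w + x *\<^sub>R K w = 0"
      then show "w = 0" using expand[OF that, of w] by simp
    qed
    ultimately obtain Z where "linear Z" "\<forall>w. Z (w + x *\<^sub>R K w) = w" "\<forall>w. Z w + x *\<^sub>R K (Z w) = w"
      using linear_injective_isomorphism[of "\<lambda>w. w + x *\<^sub>R K w"] by auto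
    then show ?thesis
      by (intro exI[of _ "Blinfun Z"]) (simp add: bounded_linear_Blinfun_apply linear_conv_bounded_linear)
  qed
  then obtain Y :: "real \<Rightarrow> 'a \<Rightarrow>\<^sub>L 'a"
    where left: "\<And>x w. \<bar>x\<bar> < r \<Longrightarrow> Y x (w + x *\<^sub>R K w) = w"
      and right: "\<And>x w. \<bar>x\<bar> < r \<Longrightarrow> Y x w + x *\<^sub>R K (Y x w) = w"
    by (metis (no_types))
  have bound: "norm (Y x) \<le> 2" if "\<bar>x\<bar> < r" for x
    using expand[OF that, of "Y x _"] right[OF that] by (intro norm_blinfun_bound) auto
  have resolvent: "Y z - Y x = (x - z) *\<^sub>R (Y z o\<^sub>L K o\<^sub>L Y x)" if "\<bar>x\<bar> < r" "\<bar>z\<bar> < r" for x z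
  proof (rule blinfun_eqI)
    fix w
    define v where "v = Y x w"
    have w: "w = v + x *\<^sub>R K v" using right[OF that(1)] v_def by simp
    \<comment> \<open>With \<open>w = (1 + x K) v\<close>, split off \<open>(1 + z K) v\<close>,
      which \<open>Y z\<close> inverts; the remainder is \<open>(x - z) K v\<close>.\<close>
    have "Y z w = Y z ((v + z *\<^sub>R K v) + (x - z) *\<^sub>R K v)"
      by (simp add: w algebra_simps)
    also have "\<dots> = v + (x - z) *\<^sub>R Y z (K v)"
      unfolding blinfun.add_right[of "Y z" "v + z *\<^sub>R K v"] left[OF that(2)] by (simp add: blinfun.scaleR_right)
    finally show "(Y z - Y x) w = ((x - z) *\<^sub>R (Y z o\<^sub>L K o\<^sub>L Y x)) w"
      by (simp add: blinfun.diff_left blinfun.scaleR_left v_def)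
  qed
  have lip: "norm (Y z - Y x) \<le> \<bar>z - x\<bar> * (2 * norm K * 2)" if "\<bar>x\<bar> < r" "\<bar>z\<bar> < r" for x z
  proof -
    have "norm (Y z o\<^sub>L K o\<^sub>L Y x) \<le> norm (Y z) * norm K * norm (Y x)"
      by (rule order_trans[OF norm_blinfun_compose mult_right_mono[OF norm_blinfun_compose]]) simp
    also have "\<dots> \<le> 2 * norm K * 2"
      using bound that by (intro mult_mono) auto
    finally show ?thesis
      unfolding resolvent[OF that] by (simp add: abs_minus_commute mult_left_mono)
  qed
  have "(Y has_vector_derivative - (Y x o\<^sub>L K o\<^sub>L Y x)) (at x)" if x: "\<bar>x\<bar> < r" for x
  proof -
    define c where "c = norm (K o\<^sub>L Y x) * (2 * norm K * 2)"
    have "(Y has_derivative (\<lambda>h. h *\<^sub>R - (Y x o\<^sub>L K o\<^sub>L Y x))) (at x)"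
    \<comment> \<open>By the resolvent identity the error of the linear approximation is
      \<open>x - z\<close> times a composite with \<open>Y z - Y x\<close>, hence quadratic by
      \<open>lip\<close>. The radius \<open>r - \<bar>x\<bar>\<close> keeps \<open>z\<close> within
      the domain of \<open>Y\<close>.\<close>
    proof (rule has_derivativeI_sandwich[where e = "r - \<bar>x\<bar>" and H = "\<lambda>z. c * \<bar>z - x\<bar>"])
      show "0 < r - \<bar>x\<bar>" using x by simp
      show "bounded_linear (\<lambda>h. h *\<^sub>R - (Y x o\<^sub>L K o\<^sub>L Y x))"
        by (rule bounded_linear_scaleR_left)
      have "((\<lambda>z. c * \<bar>z - x\<bar>) \<longlongrightarrow> c * \<bar>x - x\<bar>) (at x)"
        by (intro tendsto_intros)
      then show "((\<lambda>z. c * \<bar>z - x\<bar>) \<longlongrightarrow> 0) (at x)" by simp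
    next
      fix z assume "z \<noteq> x" "dist z x < r - \<bar>x\<bar>"
      then have z: "\<bar>z\<bar> < r" by (simp add: dist_real_def)
      have "Y z - Y x - (z - x) *\<^sub>R - (Y x o\<^sub>L K o\<^sub>L Y x)
          = (x - z) *\<^sub>R (Y z o\<^sub>L K o\<^sub>L Y x) - (z - x) *\<^sub>R - (Y x o\<^sub>L K o\<^sub>L Y x)"
        using resolvent[OF x z] by simp
      also have "\<dots> = (x - z) *\<^sub>R ((Y z - Y x) o\<^sub>L (K o\<^sub>L Y x))"
        by (rule blinfun_eqI) (simp add: blinfun.bilinear_simps algebra_simps)
      finally have eq: "norm (Y z - Y x - (z - x) *\<^sub>R - (Y x o\<^sub>L K o\<^sub>L Y x))
          = \<bar>z - x\<bar> * norm ((Y z - Y x) o\<^sub>L (K o\<^sub>L Y x))"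
        by (simp add: abs_minus_commute)
      have "norm ((Y z - Y x) o\<^sub>L (K o\<^sub>L Y x)) \<le> norm (Y z - Y x) * norm (K o\<^sub>L Y x)"
        by (rule norm_blinfun_compose)
      also have "\<dots> \<le> \<bar>z - x\<bar> * (2 * norm K * 2) * norm (K o\<^sub>L Y x)"
        using lip[OF x z] by (rule mult_right_mono) simp
      also have "\<dots> = c * \<bar>z - x\<bar>"
        by (simp add: c_def)
      finally have "norm (Y z - Y x - (z - x) *\<^sub>R - (Y x o\<^sub>L K o\<^sub>L Y x)) \<le> \<bar>z - x\<bar> * (c * \<bar>z - x\<bar>)"
        unfolding eq by (rule mult_left_mono) simp
      then show "norm (Y z - Y x - (z - x) *\<^sub>R - (Y x o\<^sub>L K o\<^sub>L Y x)) / norm (z - x) \<le> c * \<bar>z - x\<bar>"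
        using \<open>z \<noteq> x\<close> by (simp add: pos_divide_le_eq mult.commute)
    qed
    then show ?thesis by (simp add: has_vector_derivative_def)
  qed
  with r left right show ?thesis by (rule that)
qed

section \<open>Nondegenerate lines and cycles\<close>

text \<open>The affine line of the graphs of \<open>x B\<close>, with its origin
  \<open>\<Gamma>\<^sub>0\<close> on the line itself so that no constant term occurs. Injectivity of
  \<open>B\<close> on \<open>\<Gamma>\<^sub>0\<close> expresses regularity of the line.\<close>

locale nondegenerate_line =
  fixes \<omega> :: "'a::euclidean_space \<Rightarrow> 'a \<Rightarrow> real"
    and \<Gamma>\<^sub>0 \<Delta> :: "'a set" and B :: "'a \<Rightarrow>\<^sub>L 'a"
  assumes symplectic: "symplectic_form \<omega>"
    and \<Delta>: "\<Delta> \<in> lagrangian_grassmannian \<omega>"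
    and \<Gamma>\<^sub>0: "\<Gamma>\<^sub>0 \<in> transversals \<omega> \<Delta>"
    and B: "B \<in> symmetric_maps \<omega> \<Gamma>\<^sub>0 \<Delta>"
    and B_injective: "\<And>u. u \<in> \<Gamma>\<^sub>0 \<Longrightarrow> B u = 0 \<Longrightarrow> u = 0"
begin

text \<open>In the homogeneous coordinates \<open>[a : b]\<close>, the points \<open>plane 1 x\<close> form the affine line and
  \<open>plane 0 1\<close> is its point at infinity \<open>\<Delta>\<close>.\<close>

definition plane :: "real \<Rightarrow> real \<Rightarrow> 'a set" where
  "plane a b = (\<lambda>u. a *\<^sub>R u + b *\<^sub>R B u) ` \<Gamma>\<^sub>0"

sublocale \<omega>: bounded_bilinear \<omega>
  using symplectic by (simp add: symplectic_form_def bilinear_conv_bounded_bilinear)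

lemma \<omega>_skew: "\<omega> v u = - \<omega> u v"
proof -
  have "\<omega> (u + v) (u + v) = 0" "\<omega> u u = 0" "\<omega> v v = 0"
    using symplectic by (auto simp: symplectic_form_def)
  then show ?thesis by (simp add: \<omega>.add_left \<omega>.add_right)
qed

lemma \<Gamma>\<^sub>0_lagrangian: "\<Gamma>\<^sub>0 \<in> lagrangian_grassmannian \<omega>" and \<Gamma>\<^sub>0_Int_\<Delta>: "\<Gamma>\<^sub>0 \<inter> \<Delta> = {0}"
  using transversalsD[OF \<Gamma>\<^sub>0] by auto

lemmas subspace_\<Gamma>\<^sub>0 = lagrangianD(1)[OF \<Gamma>\<^sub>0_lagrangian]
  and subspace_\<Delta> = lagrangianD(1)[OF \<Delta>]

lemma B_lin_maps: "B \<in> lin_maps \<Delta>"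
  using B by (simp add: symmetric_maps_def)

lemma scaleR_B_lin_maps: "x *\<^sub>R B \<in> lin_maps \<Delta>"
  using B_lin_maps subspace_\<Delta> by (simp add: lin_maps_def blinfun.scaleR_left subspace_scale)

lemma B_in_\<Delta>: "B w \<in> \<Delta>" and B_zero_on_\<Delta>: "w \<in> \<Delta> \<Longrightarrow> B w = 0"
  using lin_mapsD[OF B_lin_maps] by auto

lemma \<omega>_B: "u \<in> \<Gamma>\<^sub>0 \<Longrightarrow> v \<in> \<Gamma>\<^sub>0 \<Longrightarrow> \<omega> (B u) v = - \<omega> u (B v)"
  using B by (simp add: symmetric_maps_def add_eq_0_iff)

lemma \<omega>_zero: "u \<in> \<Gamma>\<^sub>0 \<Longrightarrow> v \<in> \<Gamma>\<^sub>0 \<Longrightarrow> \<omega> u v = 0" "\<omega> (B u) (B v) = 0"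
  using lagrangianD(2)[OF \<Gamma>\<^sub>0_lagrangian] lagrangianD(2)[OF \<Delta>] B_in_\<Delta> by auto

section \<open>Points of the cycle in homogeneous coordinates\<close>

lemma graph_eq_plane: "graph_over \<Gamma>\<^sub>0 (x *\<^sub>R B) = plane 1 x"
  by (simp add: graph_over_def plane_def blinfun.scaleR_left)

lemma plane_1_0: "plane 1 0 = \<Gamma>\<^sub>0"
  by (simp add: plane_def)

text \<open>The difference \<open>a u - c v\<close> lies in \<open>\<Gamma>\<^sub>0\<close> and
  equals a value of \<open>B\<close>, which lies in \<Delta>; so it vanishes, and injectivity of
  \<open>B\<close> gives the second equation.\<close>

lemma plane_coordinates:
  assumes "u \<in> \<Gamma>\<^sub>0" "v \<in> \<Gamma>\<^sub>0" "a *\<^sub>R u + b *\<^sub>R B u = c *\<^sub>R v + d *\<^sub>R B v"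
  shows "a *\<^sub>R u = c *\<^sub>R v" "b *\<^sub>R u = d *\<^sub>R v"
proof -
  have eq: "a *\<^sub>R u - c *\<^sub>R v = B (d *\<^sub>R v - b *\<^sub>R u)"
    using assms(3) by (simp add: blinfun.bilinear_simps algebra_simps)
  have "a *\<^sub>R u - c *\<^sub>R v \<in> \<Gamma>\<^sub>0" "d *\<^sub>R v - b *\<^sub>R u \<in> \<Gamma>\<^sub>0"
    using assms(1,2) subspace_\<Gamma>\<^sub>0 by (auto intro!: subspace_diff subspace_scale)
  moreover have "a *\<^sub>R u - c *\<^sub>R v = 0"
    using calculation(1) eq B_in_\<Delta> \<Gamma>\<^sub>0_Int_\<Delta> by (metis IntI singletonD)
  ultimately show "a *\<^sub>R u = c *\<^sub>R v" "b *\<^sub>R u = d *\<^sub>R v"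
    using eq B_injective[of "d *\<^sub>R v - b *\<^sub>R u"] by auto
qed

text \<open>Isotropy comes from the symmetry of \<open>B\<close>: the two mixed terms
  \<open>a b \<omega>(u, B v)\<close> and \<open>a b \<omega>(B u, v)\<close> cancel. Injectivity of
  the parametrization gives the dimension.\<close>

lemma plane_lagrangian:
  assumes "a \<noteq> 0 \<or> b \<noteq> 0"
  shows "plane a b \<in> lagrangian_grassmannian \<omega>"
proof -
  let ?f = "\<lambda>u. a *\<^sub>R u + b *\<^sub>R B u"
  have lin: "linear ?f"
    by (intro linearI) (simp_all add: blinfun.bilinear_simps algebra_simps)
  have "inj_on ?f \<Gamma>\<^sub>0"
  proof (rule inj_onI)
    fix u v assume uv: "u \<in> \<Gamma>\<^sub>0" "v \<in> \<Gamma>\<^sub>0" "?f u = ?f v"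
    show "u = v" using plane_coordinates[OF uv] assms by auto
  qed
  moreover have "span \<Gamma>\<^sub>0 = \<Gamma>\<^sub>0"
    using subspace_\<Gamma>\<^sub>0 by simp
  ultimately have "dim (plane a b) = dim \<Gamma>\<^sub>0"
    unfolding plane_def using dim_image_eq[OF lin, of \<Gamma>\<^sub>0] by (simp only:)
  moreover have "subspace (plane a b)"
    unfolding plane_def using lin subspace_\<Gamma>\<^sub>0 by (rule linear_subspace_image)
  moreover have "\<omega> (?f u) (?f v) = 0" if "u \<in> \<Gamma>\<^sub>0" "v \<in> \<Gamma>\<^sub>0" for u v
    using that \<omega>_zero \<omega>_B
    by (simp add: \<omega>.add_left \<omega>.add_right \<omega>.scaleR_left \<omega>.scaleR_right)
  ultimately show ?thesis
    using lagrangianD(3)[OF \<Gamma>\<^sub>0_lagrangian]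
    by (auto simp: lagrangian_grassmannian_def plane_def)
qed

text \<open>The hypothesis says that \<open>[a : b]\<close> and \<open>[c : d]\<close> are distinct
  points. A common vector has parameters with \<open>a u = c v\<close> and \<open>b u = d v\<close>,
  whence \<open>(a d - b c) u = 0\<close>.\<close>

lemma plane_Int:
  assumes "a * d \<noteq> b * c"
  shows "plane a b \<inter> plane c d = {0}"
proof
  show "plane a b \<inter> plane c d \<subseteq> {0}"
  proof
    fix w assume "w \<in> plane a b \<inter> plane c d"
    then obtain u v where uv: "u \<in> \<Gamma>\<^sub>0" "v \<in> \<Gamma>\<^sub>0" "w = a *\<^sub>R u + b *\<^sub>R B u"
      "a *\<^sub>R u + b *\<^sub>R B u = c *\<^sub>R v + d *\<^sub>R B v"
      unfolding plane_def by auto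
    have "(a * d) *\<^sub>R u = d *\<^sub>R a *\<^sub>R u" by simp
    also have "\<dots> = c *\<^sub>R d *\<^sub>R v" using plane_coordinates(1)[OF uv(1,2,4)] by simp
    also have "\<dots> = (b * c) *\<^sub>R u" using plane_coordinates(2)[OF uv(1,2,4)] by (metis mult.commute scaleR_scaleR)
    finally have "u = 0" using assms by simp
    then show "w \<in> {0}" using uv(3) by simp
  qed
  show "{0} \<subseteq> plane a b \<inter> plane c d"
    using subspace_0[OF subspace_\<Gamma>\<^sub>0] unfolding plane_def by (force intro: image_eqI[of _ _ 0])
qed

lemma plane_0_1: "plane 0 1 = \<Delta>"
proof (rule subspace_dim_equal)
  show "subspace (plane 0 1)" "dim \<Delta> \<le> dim (plane 0 1)"
    using plane_lagrangian[of 0 1] lagrangianD(1,3)[of "plane 0 1" \<omega>] lagrangianD(3)[OF \<Delta>] by auto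
qed (use subspace_\<Delta> B_in_\<Delta> in \<open>auto simp: plane_def\<close>)

lemma plane_scale:
  assumes "r \<noteq> 0"
  shows "plane (r * a) (r * b) = plane a b"
proof -
  \<comment> \<open>Substituting \<open>s u\<close> for \<open>u\<close> gives one inclusion for
    every \<open>s\<close>; the other one is the case of the inverse factor.\<close>
  have sub: "plane (s * a) (s * b) \<subseteq> plane a b" for s a b
  proof
    fix w assume "w \<in> plane (s * a) (s * b)"
    then obtain u where "u \<in> \<Gamma>\<^sub>0" "w = (s * a) *\<^sub>R u + (s * b) *\<^sub>R B u"
      unfolding plane_def by auto
    then have "s *\<^sub>R u \<in> \<Gamma>\<^sub>0" "w = a *\<^sub>R (s *\<^sub>R u) + b *\<^sub>R B (s *\<^sub>R u)"
      using subspace_\<Gamma>\<^sub>0 by (simp_all add: subspace_scale blinfun.scaleR_right mult.commute)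
    then show "w \<in> plane a b" unfolding plane_def by blast
  qed
  show ?thesis
    using sub[of r a b] sub[of "inverse r" "r * a" "r * b"] assms by (auto simp: field_simps)
qed

lemma plane_neq: "a * d \<noteq> b * c \<Longrightarrow> plane a b \<noteq> plane c d"
proof
  assume *: "a * d \<noteq> b * c" "plane a b = plane c d"
  then have "plane a b = {0}" using plane_Int by blast
  moreover have "plane a b \<in> lagrangian_grassmannian \<omega>" using * by (intro plane_lagrangian) auto
  ultimately show False using lagrangian_nonzero by blast
qed

lemma plane_affine_inject: "plane 1 x = plane 1 y \<longleftrightarrow> x = y"
  using plane_neq[of 1 y x 1] by auto

text \<open>\<open>B\<close> maps \<open>\<Gamma>\<^sub>0\<close> onto \<Delta>, so \<open>u\<close>
  is orthogonal to \<Delta> as well as to \<open>\<Gamma>\<^sub>0\<close>, hence to the whole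
  space.\<close>

lemma \<omega>_B_nondegenerate:
  assumes "u \<in> \<Gamma>\<^sub>0" "\<And>v. v \<in> \<Gamma>\<^sub>0 \<Longrightarrow> \<omega> u (B v) = 0"
  shows "u = 0"
proof -
  obtain P where P: "\<And>w. blinfun_apply P w \<in> \<Gamma>\<^sub>0" "\<And>w. w - P w \<in> \<Delta>"
    "\<And>w. w \<in> \<Gamma>\<^sub>0 \<Longrightarrow> P w = w" "\<And>w. w \<in> \<Delta> \<Longrightarrow> P w = 0"
    by (rule lagrangian_projection[OF \<Gamma>\<^sub>0_lagrangian \<Delta> \<Gamma>\<^sub>0_Int_\<Delta>]) (rule that)
  have "\<omega> u w = 0" for w
  proof -
    have "w - P w \<in> plane 0 1" using P(2) plane_0_1 by simp
    then obtain v where "v \<in> \<Gamma>\<^sub>0" "w - P w = B v" unfolding plane_def by auto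
    then have "\<omega> u (w - P w) = 0" "\<omega> u (P w) = 0"
      using assms \<omega>_zero(1) P(1) by auto
    then show ?thesis by (simp add: \<omega>.diff_right)
  qed
  then show ?thesis using symplectic by (simp add: symplectic_form_def)
qed

text \<open>As \<open>B\<close> vanishes on \<Delta>, \<open>B (u + a B u) = B u\<close>; so the
  same \<open>B\<close> is the direction of the line seen from any of its points.\<close>

lemma shift_origin: "nondegenerate_line \<omega> (plane 1 a) \<Delta> B"
proof
  have "plane 1 a \<inter> \<Delta> = {0}"
    using plane_Int[of 1 1 a 0] plane_0_1 by simp
  then show "plane 1 a \<in> transversals \<omega> \<Delta>"
    using plane_lagrangian[of 1 a] by (simp add: transversals_def)
  have B_plane: "B (1 *\<^sub>R u + a *\<^sub>R B u) = B u" for u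
    using B_zero_on_\<Delta>[OF B_in_\<Delta>] by (simp add: blinfun.bilinear_simps)
  show "B \<in> symmetric_maps \<omega> (plane 1 a) \<Delta>"
    using B_lin_maps \<omega>_B \<omega>_zero(2) unfolding symmetric_maps_def plane_def
    by (auto simp: B_plane blinfun.bilinear_simps \<omega>.add_left \<omega>.add_right \<omega>.scaleR_left \<omega>.scaleR_right B_zero_on_\<Delta>[OF B_in_\<Delta>])
  show "u = 0" if "u \<in> plane 1 a" "B u = 0" for u
    using that B_plane B_injective unfolding plane_def by auto
qed (use symplectic \<Delta> in auto)

text \<open>Moving the origin translates the affine coordinate by \<open>a\<close> and fixes the
  point at infinity.\<close>

lemma plane_shift_origin: "nondegenerate_line.plane (plane 1 a) B c d = plane c (c * a + d)"
proof -
  have "c *\<^sub>R (u + a *\<^sub>R B u) + d *\<^sub>R B (u + a *\<^sub>R B u) = c *\<^sub>R u + (c * a + d) *\<^sub>R B u" for u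
    using B_zero_on_\<Delta>[OF B_in_\<Delta>] by (simp add: blinfun.bilinear_simps algebra_simps)
  then show ?thesis
    unfolding nondegenerate_line.plane_def[OF shift_origin] by (simp add: plane_def image_image)
qed

text \<open>The inverse of \<open>B\<close> from \<Delta> to \<open>\<Gamma>\<^sub>0\<close>,
  extended by zero, exchanges the two homogeneous coordinates and so sends the old origin to
  infinity.\<close>

lemma swap_origin:
  obtains B' where "nondegenerate_line \<omega> \<Delta> \<Gamma>\<^sub>0 B'" "\<And>a b. nondegenerate_line.plane \<Delta> B' a b = plane b a"
proof -
  obtain P where P: "\<And>w. blinfun_apply P w \<in> \<Gamma>\<^sub>0" "\<And>w. w - P w \<in> \<Delta>"
    "\<And>w. w \<in> \<Gamma>\<^sub>0 \<Longrightarrow> P w = w" "\<And>w. w \<in> \<Delta> \<Longrightarrow> P w = 0"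
    by (rule lagrangian_projection[OF \<Gamma>\<^sub>0_lagrangian \<Delta> \<Gamma>\<^sub>0_Int_\<Delta>]) (rule that)
  have lin: "linear (blinfun_apply B)"
    by (simp add: blinfun.bounded_linear_right bounded_linear.linear)
  have inj: "inj_on (blinfun_apply B) \<Gamma>\<^sub>0"
  proof (rule inj_onI)
    fix u v assume "u \<in> \<Gamma>\<^sub>0" "v \<in> \<Gamma>\<^sub>0" "B u = B v"
    then show "u = v"
      using B_injective[of "u - v"] subspace_\<Gamma>\<^sub>0 by (simp add: blinfun.diff_right subspace_diff)
  qed
  obtain g where g: "range g \<subseteq> \<Gamma>\<^sub>0" "linear g" "\<And>v. v \<in> \<Gamma>\<^sub>0 \<Longrightarrow> g (B v) = v"
    using linear_exists_left_inverse_on[OF lin subspace_\<Gamma>\<^sub>0 inj] by blast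
  \<comment> \<open>\<open>g\<close> inverts \<open>B\<close> only on its image \<Delta>; the
    projection \<open>1 - P\<close> onto \<Delta> comes first, so that \<open>B'\<close> vanishes on
    \<open>\<Gamma>\<^sub>0\<close>.\<close>
  define B' where "B' = Blinfun g o\<^sub>L (id_blinfun - P)"
  have B': "B' w = g (w - P w)" for w
    using g(2) by (simp add: B'_def blinfun.diff_left bounded_linear_Blinfun_apply linear_conv_bounded_linear)
  have B'_B: "B' (B v) = v" if "v \<in> \<Gamma>\<^sub>0" for v
    using that g(3) P(4) B_in_\<Delta> by (simp add: B')
  have B'_lin_maps: "B' \<in> lin_maps \<Gamma>\<^sub>0"
    using g(1) P(3) linear_0[OF g(2)] by (auto simp: lin_maps_def B')
  have \<Delta>_B: "\<exists>v\<in>\<Gamma>\<^sub>0. w = B v" if "w \<in> \<Delta>" for w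
    using that plane_0_1 unfolding plane_def by auto
  have line: "nondegenerate_line \<omega> \<Delta> \<Gamma>\<^sub>0 B'"
  proof
    show "\<Delta> \<in> transversals \<omega> \<Gamma>\<^sub>0"
      using \<Delta> \<Gamma>\<^sub>0_Int_\<Delta> by (auto simp: transversals_def)
    have "\<omega> (B' u) v + \<omega> u (B' v) = 0" if "u \<in> \<Delta>" "v \<in> \<Delta>" for u v
    proof -
      obtain u' v' where "u' \<in> \<Gamma>\<^sub>0" "u = B u'" "v' \<in> \<Gamma>\<^sub>0" "v = B v'"
        using \<Delta>_B[OF \<open>u \<in> \<Delta>\<close>] \<Delta>_B[OF \<open>v \<in> \<Delta>\<close>] by blast
      then show ?thesis using \<omega>_B by (simp add: B'_B)
    qed
    then show "B' \<in> symmetric_maps \<omega> \<Delta> \<Gamma>\<^sub>0"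
      using B'_lin_maps by (simp add: symmetric_maps_def)
    show "u = 0" if "u \<in> \<Delta>" "B' u = 0" for u
    proof -
      obtain v where "v \<in> \<Gamma>\<^sub>0" "u = B v" using \<Delta>_B[OF \<open>u \<in> \<Delta>\<close>] by blast
      then show ?thesis using that(2) B'_B by simp
    qed
  qed (use symplectic \<Gamma>\<^sub>0_lagrangian in auto)
  have "\<Delta> = B ` \<Gamma>\<^sub>0" using \<Delta>_B B_in_\<Delta> by auto
  then have "nondegenerate_line.plane \<Delta> B' a b = plane b a" for a b
    unfolding nondegenerate_line.plane_def[OF line] plane_def
    by (simp add: image_image B'_B add.commute cong: image_cong)
  with line show ?thesis by (rule that)
qed

end

text \<open>Taking the graph of \<open>A\<close> as origin absorbs the constant term of the line. If
  the removed point is \<Delta>, the given line remains; otherwise shift the origin to the removed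
  point and swap it with \<Delta>.\<close>

lemma regular_cycle_remove:
  fixes \<omega> :: "'a::euclidean_space \<Rightarrow> 'a \<Rightarrow> real"
  assumes "symplectic_form \<omega>" "regular_cycle \<omega> C" "\<Lambda> \<in> C"
  obtains \<Gamma>\<^sub>0 \<Delta> B where "nondegenerate_line \<omega> \<Gamma>\<^sub>0 \<Delta> B"
    "C - {\<Lambda>} = range (nondegenerate_line.plane \<Gamma>\<^sub>0 B 1)"
proof -
  obtain \<Delta> L where \<Delta>: "\<Delta> \<in> lagrangian_grassmannian \<omega>" and "affine_line \<omega> \<Delta> L"
    and regular: "regular_line L" and C: "C = insert \<Delta> L"
    using assms(2) unfolding regular_cycle_def by blast
  then obtain \<Gamma>\<^sub>0 A B where \<Gamma>\<^sub>0: "\<Gamma>\<^sub>0 \<in> transversals \<omega> \<Delta>" and A: "A \<in> symmetric_maps \<omega> \<Gamma>\<^sub>0 \<Delta>"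
    and B: "B \<in> symmetric_maps \<omega> \<Gamma>\<^sub>0 \<Delta>" and "B \<noteq> 0"
    and L: "L = range (\<lambda>s::real. graph_over \<Gamma>\<^sub>0 (A + s *\<^sub>R B))"
    unfolding affine_line_def by blast
  note \<Gamma>\<^sub>0' = transversalsD[OF \<Gamma>\<^sub>0]
  have lin: "A \<in> lin_maps \<Delta>" "B \<in> lin_maps \<Delta>"
    using A B by (auto simp: symmetric_maps_def)
  then have "A + B \<in> lin_maps \<Delta>"
    using lagrangianD(1)[OF \<Delta>] by (auto simp: lin_maps_def blinfun.add_left subspace_add)
  then have neq: "graph_over \<Gamma>\<^sub>0 A \<noteq> graph_over \<Gamma>\<^sub>0 (A + B)"
    using graph_over_inject[OF \<Gamma>\<^sub>0'(1) \<Delta> \<Gamma>\<^sub>0'(2), of A "A + B"] lin(1) \<open>B \<noteq> 0\<close> by auto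
  \<comment> \<open>The points with parameters 0 and 1 are all that is used of regularity: it makes
    their graphs meet only in 0.\<close>
  have "graph_over \<Gamma>\<^sub>0 (A + 0 *\<^sub>R B) \<in> L" "graph_over \<Gamma>\<^sub>0 (A + 1 *\<^sub>R B) \<in> L"
    unfolding L by blast+
  then have "graph_over \<Gamma>\<^sub>0 A \<in> L" "graph_over \<Gamma>\<^sub>0 (A + B) \<in> L"
    by simp_all
  then have Int: "graph_over \<Gamma>\<^sub>0 A \<inter> graph_over \<Gamma>\<^sub>0 (A + B) = {0}"
    using regular neq unfolding regular_line_def by blast
  have injA: "u = 0" if "u \<in> \<Gamma>\<^sub>0" "u + A u = 0" for u
  proof -
    have "- A u \<in> \<Delta>" using lin_mapsD(1)[OF lin(1)] lagrangianD(1)[OF \<Delta>] by (simp add: subspace_neg)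
    then have "u \<in> \<Gamma>\<^sub>0 \<inter> \<Delta>" using that by (metis IntI eq_neg_iff_add_eq_0)
    then show ?thesis using \<Gamma>\<^sub>0'(2) by blast
  qed
  \<comment> \<open>A kernel vector \<open>u\<close> of \<open>B\<close> would put
    \<open>u + A u\<close> on both graphs.\<close>
  have injB: "u = 0" if "u \<in> \<Gamma>\<^sub>0" "B u = 0" for u
  proof -
    have "u + A u = u + (A + B) u" using that by (simp add: blinfun.add_left)
    then have "u + A u \<in> graph_over \<Gamma>\<^sub>0 A \<inter> graph_over \<Gamma>\<^sub>0 (A + B)"
      using \<open>u \<in> \<Gamma>\<^sub>0\<close> unfolding graph_over_def by (metis (no_types) IntI image_eqI)
    then show ?thesis using Int injA \<open>u \<in> \<Gamma>\<^sub>0\<close> by blast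
  qed
  interpret \<omega>: nondegenerate_line \<omega> \<Gamma>\<^sub>0 \<Delta> B
    by unfold_locales (use assms(1) \<Delta> \<Gamma>\<^sub>0 B injB in auto)
  have sA: "\<omega> (A u) v + \<omega> u (A v) = 0" if "u \<in> \<Gamma>\<^sub>0" "v \<in> \<Gamma>\<^sub>0" for u v
    using A that by (simp add: symmetric_maps_def)
  have AA: "A (A u) = 0" "B (A u) = 0" for u
    using lin_mapsD[OF lin(1)] lin_mapsD(2)[OF lin(2)] by auto
  let ?\<Gamma>\<^sub>1 = "graph_over \<Gamma>\<^sub>0 A"
  have linA: "linear (\<lambda>u. u + A u)"
    by (intro linearI) (simp_all add: blinfun.bilinear_simps algebra_simps)
  have subsp: "subspace ?\<Gamma>\<^sub>1"
    unfolding graph_over_def using linA \<omega>.subspace_\<Gamma>\<^sub>0 by (rule linear_subspace_image)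
  have "inj_on (\<lambda>u. u + A u) \<Gamma>\<^sub>0"
    unfolding linear_inj_on_iff_eq_0[OF linA \<omega>.subspace_\<Gamma>\<^sub>0] using injA by blast
  moreover have "span \<Gamma>\<^sub>0 = \<Gamma>\<^sub>0"
    using \<omega>.subspace_\<Gamma>\<^sub>0 by simp
  ultimately have "dim ?\<Gamma>\<^sub>1 = dim \<Gamma>\<^sub>0"
    unfolding graph_over_def using dim_image_eq[OF linA, of \<Gamma>\<^sub>0] by (simp only:)
  then have "?\<Gamma>\<^sub>1 \<in> lagrangian_grassmannian \<omega>"
    using subsp sA \<omega>.\<omega>_zero(1) lagrangianD(3)[OF \<Gamma>\<^sub>0'(1)] lagrangianD(2)[OF \<Delta>] lin_mapsD(1)[OF lin(1)]
    by (auto simp: lagrangian_grassmannian_def graph_over_def \<omega>.\<omega>.add_left \<omega>.\<omega>.add_right)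
  moreover have "?\<Gamma>\<^sub>1 \<inter> \<Delta> = {0}"
  proof
    show "?\<Gamma>\<^sub>1 \<inter> \<Delta> \<subseteq> {0}"
    proof
      fix w assume "w \<in> ?\<Gamma>\<^sub>1 \<inter> \<Delta>"
      then obtain u where u: "u \<in> \<Gamma>\<^sub>0" "w = u + A u" "w \<in> \<Delta>" unfolding graph_over_def by blast
      then have "w - A u \<in> \<Delta>"
        using lin_mapsD(1)[OF lin(1)] \<omega>.subspace_\<Delta> subspace_diff by blast
      then have "u \<in> \<Gamma>\<^sub>0 \<inter> \<Delta>" using u by simp
      then have "u = 0" using \<Gamma>\<^sub>0'(2) by blast
      then show "w \<in> {0}" using u(2) by simp
    qed
  qed (use subsp \<omega>.subspace_\<Delta> subspace_0 in auto)
  ultimately have "?\<Gamma>\<^sub>1 \<in> transversals \<omega> \<Delta>" by (simp add: transversals_def)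
  moreover have "\<omega> (B u) v + \<omega> u (B v) = 0" if "u \<in> ?\<Gamma>\<^sub>1" "v \<in> ?\<Gamma>\<^sub>1" for u v
    using that \<omega>.\<omega>_B lagrangianD(2)[OF \<Delta>] lin_mapsD(1)[OF lin(1)] \<omega>.B_in_\<Delta>
    by (auto simp: graph_over_def blinfun.add_right AA \<omega>.\<omega>.add_left \<omega>.\<omega>.add_right)
  then have "B \<in> symmetric_maps \<omega> ?\<Gamma>\<^sub>1 \<Delta>"
    using lin(2) by (simp add: symmetric_maps_def)
  moreover have "u = 0" if "u \<in> ?\<Gamma>\<^sub>1" "B u = 0" for u
    using that injB unfolding graph_over_def by (force simp: blinfun.add_right AA)
  ultimately have line: "nondegenerate_line \<omega> ?\<Gamma>\<^sub>1 \<Delta> B"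
    using assms(1) \<Delta> by unfold_locales auto
  interpret L: nondegenerate_line \<omega> ?\<Gamma>\<^sub>1 \<Delta> B by fact
  \<comment> \<open>Since \<open>B (u + A u) = B u\<close>, the parameter \<open>s\<close> is the
    affine coordinate from the new origin.\<close>
  have "graph_over \<Gamma>\<^sub>0 (A + s *\<^sub>R B) = L.plane 1 s" for s
    unfolding L.plane_def unfolding graph_over_def
    by (simp add: image_image blinfun.bilinear_simps AA add.assoc)
  then have C_plane: "C = insert (L.plane 0 1) (range (L.plane 1))"
    using C L L.plane_0_1 by simp
  consider "\<Lambda> = \<Delta>" | a where "\<Lambda> = L.plane 1 a"
    using assms(3) C_plane L.plane_0_1 by auto
  then show ?thesis
  proof cases
    case 1
    have "L.plane 0 1 \<notin> range (L.plane 1)"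
      using L.plane_neq[of 0 _ 1 1] by auto
    then have "C - {\<Lambda>} = range (L.plane 1)"
      using 1 C_plane L.plane_0_1 by auto
    with line show ?thesis by (rule that)
  next
    case (2 a)
    interpret M: nondegenerate_line \<omega> "L.plane 1 a" \<Delta> B by (rule L.shift_origin)
    obtain B' where B': "nondegenerate_line \<omega> \<Delta> (L.plane 1 a) B'"
      "\<And>a' b. nondegenerate_line.plane \<Delta> B' a' b = M.plane b a'"
      using M.swap_origin by blast
    \<comment> \<open>After shift and swap, the new coordinate \<open>r\<close> denotes the old
      point \<open>a + 1 / r\<close>, and \<open>r = 0\<close> denotes \<Delta>. Solving for
      \<open>r\<close> gives the witness \<open>1 / (x - a)\<close> below.\<close>
    then have plane: "nondegenerate_line.plane \<Delta> B' 1 r = L.plane r (r * a + 1)" for r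
      using L.plane_shift_origin by simp
    have "C - {\<Lambda>} = range (\<lambda>r. L.plane r (r * a + 1))"
    proof (intro equalityI subsetI)
      fix X assume X: "X \<in> C - {\<Lambda>}"
      show "X \<in> range (\<lambda>r. L.plane r (r * a + 1))"
      proof (cases "X = L.plane 0 1")
        case True
        then show ?thesis by (intro image_eqI[of _ _ 0]) auto
      next
        case False
        then obtain x where x: "X = L.plane 1 x" using X C_plane by auto
        then have "x \<noteq> a" using X 2 by auto
        then have "1 / (x - a) * x = 1 / (x - a) * a + 1" by (simp add: field_simps)
        then have "X = L.plane (1 / (x - a)) (1 / (x - a) * a + 1)"
          using x L.plane_scale[of "1 / (x - a)" 1 x] \<open>x \<noteq> a\<close> by simp
        then show ?thesis by blast
      qed
    next
      fix X assume "X \<in> range (\<lambda>r. L.plane r (r * a + 1))"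
      then obtain r where r: "X = L.plane r (r * a + 1)" by blast
      have "X \<in> C"
      proof (cases "r = 0")
        case False
        then have "X = L.plane 1 (a + 1 / r)"
          using r L.plane_scale[of r 1 "a + 1 / r"] by (simp add: algebra_simps)
        then show ?thesis using C_plane by blast
      qed (use r C_plane in simp)
      moreover have "X \<noteq> \<Lambda>"
        unfolding r 2 by (rule L.plane_neq) simp
      ultimately show "X \<in> C - {\<Lambda>}" by simp
    qed
    then have "C - {\<Lambda>} = range (nondegenerate_line.plane \<Delta> B' 1)"
      using plane by (simp add: fun_eq_iff[symmetric] eta_contract_eq)
    with B'(1) show ?thesis by (rule that)
  qed
qed

section \<open>Jacobi curves on a line\<close>

context nondegenerate_line
begin

text \<open>The section \<open>u + g(t) B u\<close> has velocity \<open>g' B u\<close>, which yields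
  the value. Uniqueness of the value has to be shown because of the definite description.\<close>

lemma velocity_form_plane:
  assumes "open U" "\<tau> \<in> U" "smooth_on U g" "\<And>t. t \<in> U \<Longrightarrow> \<Gamma> t = plane 1 (g t)" "u \<in> \<Gamma>\<^sub>0"
  shows "velocity_form \<omega> \<Gamma> \<tau> (u + g \<tau> *\<^sub>R B u) = vector_derivative g (at \<tau>) * \<omega> u (B u)"
proof -
  let ?v = "\<lambda>t. u + g t *\<^sub>R B u" and ?c = "vector_derivative g (at \<tau>) * \<omega> u (B u)"
  have v: "(?v has_vector_derivative vector_derivative g (at \<tau>) *\<^sub>R B u) (at \<tau>)"
    using has_vector_derivative_add[OF has_vector_derivative_const
      bounded_linear.has_vector_derivative[OF bounded_linear_scaleR_left
        smooth_on_has_vector_derivative[OF assms(3,2)]], of u "B u"] by simp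
  have v_in: "?v t \<in> \<Gamma> t" if "t \<in> U" for t
    using assms(4)[OF that] assms(5) unfolding plane_def by auto
  have c: "\<omega> (?v \<tau>) (vector_derivative g (at \<tau>) *\<^sub>R B u) = ?c"
    using \<omega>_zero(2) by (simp add: \<omega>.add_left \<omega>.scaleR_left \<omega>.scaleR_right)
  show ?thesis
    unfolding velocity_form_def
  proof (rule the_equality)
    have "smooth_on U ?v"
      by (intro smooth_on_add smooth_on_const bounded_linear.smooth_on[OF bounded_linear_scaleR_left] assms(1,3))
    moreover have "?c = \<omega> (?v \<tau>) (vector_derivative ?v (at \<tau>))"
      using c vector_derivative_at[OF v] by simp
    ultimately show "\<exists>v U. open U \<and> \<tau> \<in> U \<and> smooth_on U v \<and> (\<forall>t\<in>U. v t \<in> \<Gamma> t) \<and>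
        v \<tau> = ?v \<tau> \<and> ?c = \<omega> (?v \<tau>) (vector_derivative v (at \<tau>))"
      using assms(1,2) v_in by blast
  next
    fix d
    assume "\<exists>w V. open V \<and> \<tau> \<in> V \<and> smooth_on V w \<and> (\<forall>t\<in>V. w t \<in> \<Gamma> t) \<and>
        w \<tau> = ?v \<tau> \<and> d = \<omega> (?v \<tau>) (vector_derivative w (at \<tau>))"
    then obtain w V where w: "open V" "\<tau> \<in> V" "smooth_on V w" "\<And>t. t \<in> V \<Longrightarrow> w t \<in> \<Gamma> t"
      "w \<tau> = ?v \<tau>" "d = \<omega> (?v \<tau>) (vector_derivative w (at \<tau>))"
      by blast
    \<comment> \<open>Two sections of a curve of isotropic spaces are orthogonal at each time.
      Differentiating this relation compares the velocity of \<open>w\<close> with that of the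
      explicit section.\<close>
    have "\<omega> (w t) (?v t) = 0" if "t \<in> U \<inter> V" for t
      using lagrangianD(2)[OF plane_lagrangian[of 1 "g t"]] w(4)[of t] v_in[of t] assms(4)[of t] that
      by simp
    then have "((\<lambda>t. \<omega> (w t) (?v t)) has_vector_derivative 0) (at \<tau>)"
      using assms(1,2) w(1,2)
      by (intro has_vector_derivative_transform_within_open[OF has_vector_derivative_const, of "U \<inter> V" \<tau> 0]) auto
    moreover have "((\<lambda>t. \<omega> (w t) (?v t)) has_vector_derivative
        \<omega> (w \<tau>) (vector_derivative g (at \<tau>) *\<^sub>R B u) + \<omega> (vector_derivative w (at \<tau>)) (?v \<tau>)) (at \<tau>)"
      using smooth_on_has_vector_derivative[OF w(3,2)] v by (rule \<omega>.has_vector_derivative)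
    ultimately have "\<omega> (w \<tau>) (vector_derivative g (at \<tau>) *\<^sub>R B u) + \<omega> (vector_derivative w (at \<tau>)) (?v \<tau>) = 0"
      by (rule vector_derivative_unique_at[symmetric])
    then show "d = ?c"
      using c w(5,6) \<omega>_skew[of "vector_derivative w (at \<tau>)" "?v \<tau>"] by simp
  qed
qed

text \<open>The polar form is \<open>2 g' \<omega>(u, B v)\<close>, and the pairing
  \<open>\<omega>(u, B v)\<close> is nondegenerate on \<open>\<Gamma>\<^sub>0\<close>.\<close>

lemma nondegenerate_velocity_form_plane:
  assumes "open U" "\<tau> \<in> U" "smooth_on U g" "\<And>t. t \<in> U \<Longrightarrow> \<Gamma> t = plane 1 (g t)"
  shows "nondegenerate_quadratic_on (\<Gamma> \<tau>) (velocity_form \<omega> \<Gamma> \<tau>) \<longleftrightarrow> vector_derivative g (at \<tau>) \<noteq> 0"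
proof -
  let ?g' = "vector_derivative g (at \<tau>)" and ?p = "\<lambda>u. u + g \<tau> *\<^sub>R B u" and ?q = "velocity_form \<omega> \<Gamma> \<tau>"
  have \<Gamma>: "\<Gamma> \<tau> = ?p ` \<Gamma>\<^sub>0"
    using assms(2,4) by (simp add: plane_def)
  have polar: "?q (?p u + ?p v) - ?q (?p u) - ?q (?p v) = 2 * ?g' * \<omega> u (B v)"
    if "u \<in> \<Gamma>\<^sub>0" "v \<in> \<Gamma>\<^sub>0" for u v
  proof -
    have "?p u + ?p v = ?p (u + v)" by (simp add: blinfun.add_right scaleR_add_right)
    then have "?q (?p u + ?p v) = ?g' * \<omega> (u + v) (B (u + v))"
      using velocity_form_plane[OF assms subspace_add[OF subspace_\<Gamma>\<^sub>0 that]] by (simp only:)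
    moreover have "\<omega> v (B u) = \<omega> u (B v)"
      using \<omega>_B[OF that] \<omega>_skew[of v "B u"] by simp
    ultimately show ?thesis
      using velocity_form_plane[OF assms that(1)] velocity_form_plane[OF assms that(2)]
      by (simp add: blinfun.add_right \<omega>.add_left \<omega>.add_right distrib_left)
  qed
  show ?thesis
  proof
    assume nd: "nondegenerate_quadratic_on (\<Gamma> \<tau>) ?q"
    \<comment> \<open>On the zero space even the zero form would be nondegenerate, so a nonzero
      vector is needed here.\<close>
    obtain u where u: "u \<in> \<Gamma>\<^sub>0" "u \<noteq> 0" using lagrangian_nonzero[OF \<Gamma>\<^sub>0_lagrangian] by blast
    have "?p u \<noteq> 0"
      using plane_coordinates(1)[of u 0 1 "g \<tau>" 1 "g \<tau>"] u subspace_0[OF subspace_\<Gamma>\<^sub>0] by auto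
    then obtain w where "w \<in> \<Gamma> \<tau>" "?q (?p u + w) - ?q (?p u) - ?q w \<noteq> 0"
      using nd u(1) unfolding nondegenerate_quadratic_on_def \<Gamma> by blast
    then show "?g' \<noteq> 0" using polar[OF u(1)] unfolding \<Gamma> by auto
  next
    assume "?g' \<noteq> 0"
    show "nondegenerate_quadratic_on (\<Gamma> \<tau>) ?q"
      unfolding nondegenerate_quadratic_on_def
    proof (intro ballI impI)
      fix w assume "w \<in> \<Gamma> \<tau>" and zero: "\<forall>v\<in>\<Gamma> \<tau>. ?q (w + v) - ?q w - ?q v = 0"
      then obtain u where u: "u \<in> \<Gamma>\<^sub>0" "w = ?p u" using \<Gamma> by blast
      have "\<omega> u (B v) = 0" if "v \<in> \<Gamma>\<^sub>0" for v
        using zero polar[OF u(1) that] that \<open>?g' \<noteq> 0\<close> unfolding \<Gamma> u(2) by simp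
      then have "u = 0" using \<omega>_B_nondegenerate u(1) by blast
      then show "w = 0" using u(2) by simp
    qed
  qed
qed

text \<open>A single chart, that of \<Delta> with origin \<open>\<Gamma>\<^sub>0\<close>, covers the
  curve, which reads \<open>t B\<close> there.\<close>

lemma injective_jacobi_curve_onto_line: "injective_jacobi_curve_onto \<omega> (range (plane 1)) UNIV (plane 1)"
proof -
  have trans: "plane 1 t \<in> transversals \<omega> \<Delta>" for t
    using plane_lagrangian[of 1 t] plane_Int[of 1 1 t 0] plane_0_1 by (simp add: transversals_def)
  have "graph_chart \<Gamma>\<^sub>0 \<Delta> (plane 1 t) = t *\<^sub>R B" for t
    using graph_chart_graph_over[OF \<Gamma>\<^sub>0_lagrangian \<Delta> \<Gamma>\<^sub>0_Int_\<Delta> scaleR_B_lin_maps] graph_eq_plane by simp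
  then have "smooth_on UNIV (\<lambda>t. graph_chart \<Gamma>\<^sub>0 \<Delta> (plane 1 t))"
    using bounded_linear.smooth_on[OF bounded_linear_scaleR_left open_UNIV smooth_on_ident[OF open_UNIV]]
    by simp
  then have "smooth_lagrangian_curve \<omega> UNIV (plane 1)"
    unfolding smooth_lagrangian_curve_def using \<Delta> \<Gamma>\<^sub>0 trans
    by (intro conjI ballI bexI[of _ \<Delta>] bexI[of _ \<Gamma>\<^sub>0] exI[of _ UNIV]) (auto intro!: plane_lagrangian)
  moreover have "nondegenerate_quadratic_on (plane 1 t) (velocity_form \<omega> (plane 1) t)" for t
    by (subst nondegenerate_velocity_form_plane[of UNIV t "\<lambda>t. t"]) (simp_all add: smooth_on_ident)
  ultimately show ?thesis
    unfolding injective_jacobi_curve_onto_def jacobi_curve_def open_interval_def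
    by (simp add: inj_on_def plane_affine_inject)
qed

text \<open>The coordinate of \<open>\<gamma>\<close> on the line is a quotient of two smooth functions: if \<open>w\<close> is a smooth
  nowhere vanishing section of \<open>\<gamma>\<close>, then \<open>w - P w = g (B w)\<close>.\<close>

lemma jacobi_curve_in_line:
  assumes "jacobi_curve \<omega> I \<gamma>" "\<gamma> ` I \<subseteq> range (plane 1)"
  obtains g where "smooth_on I g" "\<And>s. s \<in> I \<Longrightarrow> \<gamma> s = plane 1 (g s)"
    "\<And>s. s \<in> I \<Longrightarrow> vector_derivative g (at s) \<noteq> 0"
proof -
  have I: "open I" and smooth: "smooth_lagrangian_curve \<omega> I \<gamma>"
    and nd: "\<And>s. s \<in> I \<Longrightarrow> nondegenerate_quadratic_on (\<gamma> s) (velocity_form \<omega> \<gamma> s)"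
    using assms(1) by (auto simp: jacobi_curve_def open_interval_def)
  have "\<exists>x. \<gamma> s = plane 1 x" if "s \<in> I" for s
    using assms(2) that by blast
  then obtain g where g: "\<And>s. s \<in> I \<Longrightarrow> \<gamma> s = plane 1 (g s)" by metis
  obtain P where P: "\<And>w. blinfun_apply P w \<in> \<Gamma>\<^sub>0" "\<And>w. w - P w \<in> \<Delta>"
    "\<And>w. w \<in> \<Gamma>\<^sub>0 \<Longrightarrow> P w = w" "\<And>w. w \<in> \<Delta> \<Longrightarrow> P w = 0"
    by (rule lagrangian_projection[OF \<Gamma>\<^sub>0_lagrangian \<Delta> \<Gamma>\<^sub>0_Int_\<Delta>]) (rule that)
  have coord: "w - P w = x *\<^sub>R B w" "B w = 0 \<Longrightarrow> w = 0" if "w \<in> plane 1 x" for w x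
  proof -
    obtain u where u: "u \<in> \<Gamma>\<^sub>0" "w = u + x *\<^sub>R B u" using \<open>w \<in> plane 1 x\<close> unfolding plane_def by auto
    have "P w = u" "B w = B u"
      using u P(3) P(4)[OF B_in_\<Delta>] B_zero_on_\<Delta>[OF B_in_\<Delta>] by (simp_all add: blinfun.bilinear_simps)
    then show "w - P w = x *\<^sub>R B w" "B w = 0 \<Longrightarrow> w = 0"
      using u B_injective by auto
  qed
  have local: "\<exists>V. open V \<and> \<tau> \<in> V \<and> smooth_on V g" if "\<tau> \<in> I" for \<tau>
  proof -
    obtain \<Delta>\<^sub>1 \<Gamma>\<^sub>1 U where \<Delta>\<^sub>1: "\<Delta>\<^sub>1 \<in> lagrangian_grassmannian \<omega>" and \<Gamma>\<^sub>1: "\<Gamma>\<^sub>1 \<in> transversals \<omega> \<Delta>\<^sub>1"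
      and U: "U \<subseteq> I" "open U" "\<tau> \<in> U" and trans: "\<And>t. t \<in> U \<Longrightarrow> \<gamma> t \<in> transversals \<omega> \<Delta>\<^sub>1"
      and chart: "smooth_on U (\<lambda>t. graph_chart \<Gamma>\<^sub>1 \<Delta>\<^sub>1 (\<gamma> t))"
      using smooth \<open>\<tau> \<in> I\<close> unfolding smooth_lagrangian_curve_def by meson
    let ?A = "\<lambda>t. graph_chart \<Gamma>\<^sub>1 \<Delta>\<^sub>1 (\<gamma> t)"
    have A: "?A t \<in> lin_maps \<Delta>\<^sub>1" "graph_over \<Gamma>\<^sub>1 (?A t) = \<gamma> t" if "t \<in> U" for t
      using graph_chart_works[OF \<Delta>\<^sub>1 \<Gamma>\<^sub>1 trans[OF that]] by auto
    obtain w\<^sub>0 where w\<^sub>0: "w\<^sub>0 \<in> \<Gamma>\<^sub>1" "w\<^sub>0 \<noteq> 0"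
      using lagrangian_nonzero[OF transversalsD(1)[OF \<Gamma>\<^sub>1]] by blast
    define w where "w t = w\<^sub>0 + ?A t w\<^sub>0" for t
    have w_in: "w t \<in> plane 1 (g t)" if "t \<in> U" for t
      using A(2)[OF that] g[of t] U(1) that w\<^sub>0(1) unfolding w_def graph_over_def by auto
    \<comment> \<open>A zero of \<open>w\<close> would put the nonzero vector
      \<open>w\<^sub>0\<close> of \<open>\<Gamma>\<^sub>1\<close> into
      \<open>\<Delta>\<^sub>1\<close>.\<close>
    have "w \<tau> \<noteq> 0"
    proof
      assume "w \<tau> = 0"
      then have "w\<^sub>0 = - ?A \<tau> w\<^sub>0" unfolding w_def by (simp add: eq_neg_iff_add_eq_0)
      moreover have "- ?A \<tau> w\<^sub>0 \<in> \<Delta>\<^sub>1"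
        using lin_mapsD(1)[OF A(1)[OF U(3)]] lagrangianD(1)[OF \<Delta>\<^sub>1] by (simp add: subspace_neg)
      ultimately show False using w\<^sub>0 transversalsD(2)[OF \<Gamma>\<^sub>1] by auto
    qed
    then have Bw: "B (w \<tau>) \<noteq> 0" using coord(2)[OF w_in[OF U(3)]] by blast
    have w: "smooth_on U w"
      unfolding w_def
      by (intro smooth_on_add smooth_on_const U(2) bounded_linear.smooth_on[OF blinfun.bounded_linear_left] chart)
    \<comment> \<open>Pairing with this fixed vector turns \<open>w - P w = g (B w)\<close> into a
      scalar equation whose denominator is positive at \<tau>, hence nonzero near \<tau>.\<close>
    define c where "c = B (w \<tau>)"
    have num: "smooth_on U (\<lambda>t. ((id_blinfun - P) (w t)) \<bullet> c)"
      and den: "smooth_on U (\<lambda>t. B (w t) \<bullet> c)"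
      by (intro bounded_linear.smooth_on[OF bounded_linear_inner_left]
          bounded_linear.smooth_on[OF blinfun.bounded_linear_right] U(2) w)+
    define V where "V = {t \<in> U. B (w t) \<bullet> c \<noteq> 0}"
    have "V = U \<inter> (\<lambda>t. B (w t) \<bullet> c) -` (- {0})" unfolding V_def by auto
    then have V: "open V" "V \<subseteq> U"
      using smooth_on_continuous_on[OF den] U(2) by (auto intro!: continuous_open_preimage)
    have "\<tau> \<in> V" using Bw U(3) by (simp add: V_def c_def)
    moreover have "smooth_on V g"
    proof (rule smooth_on_cong_open[OF V(1)])
      show "smooth_on V (\<lambda>t. (((id_blinfun - P) (w t)) \<bullet> c) / (B (w t) \<bullet> c))"
        using V num den by (intro smooth_on_divide) (auto simp: V_def intro: smooth_on_subset)
      fix t assume "t \<in> V"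
      then have "(id_blinfun - P) (w t) \<bullet> c = g t * (B (w t) \<bullet> c)"
        using coord(1)[OF w_in[of t]] by (simp add: V_def blinfun.diff_left)
      then show "g t = (((id_blinfun - P) (w t)) \<bullet> c) / (B (w t) \<bullet> c)"
        using \<open>t \<in> V\<close> by (simp add: V_def)
    qed
    ultimately show ?thesis using V(1) by blast
  qed
  have "smooth_on I g"
    unfolding smooth_on_def
  proof (intro allI ballI)
    fix k \<tau> assume "\<tau> \<in> I"
    then obtain V where "\<tau> \<in> V" "smooth_on V g" using local by blast
    then show "nth_deriv k g differentiable (at \<tau>)" unfolding smooth_on_def by blast
  qed
  moreover have "vector_derivative g (at s) \<noteq> 0" if "s \<in> I" for s
    using nondegenerate_velocity_form_plane[OF I that \<open>smooth_on I g\<close> g] nd[OF that] by simp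
  ultimately show ?thesis using g by (intro that)
qed

end

section \<open>Curvature\<close>

context nondegenerate_line
begin

text \<open>With \<open>P\<close> in the role of the projection onto \<open>\<Gamma>\<^sub>0\<close>
  along \<open>D\<close>, the vector \<open>u + x B u\<close> has components
  \<open>u + x P (B u)\<close> and \<open>x (B u - P (B u))\<close>, and the chart maps the first to
  the second. By \<open>onto\<close>, the first components fill
  \<open>\<Gamma>\<^sub>0\<close>.\<close>

lemma graph_chart_plane:
  assumes D: "D \<in> transversals \<omega> \<Gamma>\<^sub>0"
    and A: "A \<in> lin_maps D" and onto: "(\<lambda>u. u + x *\<^sub>R blinfun_apply P (B u)) ` \<Gamma>\<^sub>0 = \<Gamma>\<^sub>0"
    and eq: "\<And>u. u \<in> \<Gamma>\<^sub>0 \<Longrightarrow> A (u + x *\<^sub>R P (B u)) = x *\<^sub>R (B u - P (B u))"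
  shows "graph_chart \<Gamma>\<^sub>0 D (plane 1 x) = A"
proof -
  have "graph_over \<Gamma>\<^sub>0 A = (\<lambda>u. u + A u) ` (\<lambda>u. u + x *\<^sub>R P (B u)) ` \<Gamma>\<^sub>0"
    by (simp add: graph_over_def onto)
  also have "\<dots> = plane 1 x"
    by (simp add: image_image plane_def eq scaleR_diff_right cong: image_cong)
  finally have "graph_over \<Gamma>\<^sub>0 A = plane 1 x" .
  moreover have "\<Gamma>\<^sub>0 \<inter> D = {0}" using transversalsD(2)[OF D] by blast
  ultimately show ?thesis
    using graph_chart_graph_over[OF \<Gamma>\<^sub>0_lagrangian transversalsD(1)[OF D] _ A] by simp
qed

text \<open>In the chart the curve is \<open>F(h(t))\<close> with
  \<open>F(x) = x N (1 + x K)^-1\<close>. Since \<open>F'(0) = N\<close> and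
  \<open>F''(0) = - 2 N K\<close>, the chain rule gives \<open>h'' N - 2 h'^2 N K\<close>.\<close>

lemma chart_deriv_2_plane:
  assumes D: "D \<in> transversals \<omega> \<Gamma>\<^sub>0"
    and P: "\<And>w. blinfun_apply P w \<in> \<Gamma>\<^sub>0" "\<And>w. w - P w \<in> D"
      "\<And>w. w \<in> \<Gamma>\<^sub>0 \<Longrightarrow> P w = w" "\<And>w. w \<in> D \<Longrightarrow> P w = 0"
    and J: "open J" "\<tau> \<in> J" and h: "smooth_on J h" "h \<tau> = 0"
    and \<Gamma>: "\<And>t. t \<in> J \<Longrightarrow> \<Gamma> t = plane 1 (h t)"
    and u: "u \<in> \<Gamma>\<^sub>0"
  shows "chart_deriv \<Gamma> \<tau> D 2 u =
    (let y = nth_deriv 2 h \<tau> *\<^sub>R u - (2 * (vector_derivative h (at \<tau>))\<^sup>2) *\<^sub>R P (B u) in B y - P (B y))"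
proof -
  define N where "N = (id_blinfun - P) o\<^sub>L B o\<^sub>L P"
  define K where "K = P o\<^sub>L B o\<^sub>L P"
  have N: "N w = B (P w) - P (B (P w))" and K: "K w = P (B (P w))" for w
    by (simp_all add: N_def K_def blinfun.diff_left)
  obtain r Y where r: "r > 0" and left: "\<And>x w. \<bar>x\<bar> < r \<Longrightarrow> blinfun_apply (Y x) (w + x *\<^sub>R K w) = w"
    and right: "\<And>x w. \<bar>x\<bar> < r \<Longrightarrow> Y x w + x *\<^sub>R K (Y x w) = w"
    and Y': "\<And>x. \<bar>x\<bar> < r \<Longrightarrow> (Y has_vector_derivative - (Y x o\<^sub>L K o\<^sub>L Y x)) (at x)"
    by (rule resolvent_has_vector_derivative[of K]) (rule that)
  define E where "E x = N o\<^sub>L (Y x o\<^sub>L K o\<^sub>L Y x)" for x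
  define F where "F x = x *\<^sub>R (N o\<^sub>L Y x)" for x
  define G where "G x = (N o\<^sub>L Y x) - x *\<^sub>R E x" for x
  have chart: "graph_chart \<Gamma>\<^sub>0 D (plane 1 x) = F x" if x: "\<bar>x\<bar> < r" for x
  proof (rule graph_chart_plane[OF D, where P = P])
    have KP: "K v = P (B v)" if "v \<in> \<Gamma>\<^sub>0" for v using that P(3) by (simp add: K)
    show "F x \<in> lin_maps D"
    proof -
      \<comment> \<open>\<open>K\<close> vanishes on \<open>D\<close>, so the resolvent fixes
        \<open>D\<close> pointwise.\<close>
      have "Y x w = w" if "w \<in> D" for w
        using left[OF x, of w] P(4)[OF that] by (simp add: K)
      then show ?thesis
        using P(2,4) lagrangianD(1)[OF transversalsD(1)[OF D]]
        by (simp add: lin_maps_def F_def N blinfun.scaleR_left subspace_scale)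
    qed
    show "(\<lambda>u. u + x *\<^sub>R P (B u)) ` \<Gamma>\<^sub>0 = \<Gamma>\<^sub>0"
    proof (intro equalityI subsetI)
      fix w assume w: "w \<in> \<Gamma>\<^sub>0"
      have "Y x w = w - x *\<^sub>R K (Y x w)" using right[OF x, of w] by (simp add: algebra_simps)
      then have "Y x w \<in> \<Gamma>\<^sub>0"
        using w P(1) subspace_\<Gamma>\<^sub>0 K by (metis subspace_diff subspace_scale)
      then show "w \<in> (\<lambda>u. u + x *\<^sub>R P (B u)) ` \<Gamma>\<^sub>0"
        using right[OF x, of w] KP by (intro image_eqI[of _ _ "Y x w"]) simp_all
    qed (use P(1) subspace_\<Gamma>\<^sub>0 in \<open>auto intro!: subspace_add subspace_scale\<close>)
    show "F x (v + x *\<^sub>R P (B v)) = x *\<^sub>R (B v - P (B v))" if "v \<in> \<Gamma>\<^sub>0" for v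
      using left[OF x, of v] P(3)[OF that] by (simp add: F_def N KP[OF that] blinfun.scaleR_left)
  qed
  have NY: "((\<lambda>x. N o\<^sub>L Y x) has_vector_derivative - E x) (at x)" if "\<bar>x\<bar> < r" for x
    using bounded_linear.has_vector_derivative[OF
      bounded_bilinear.bounded_linear_right[OF bounded_bilinear_blinfun_compose] Y'[OF that], of N]
    by (simp add: E_def bounded_bilinear.minus_right[OF bounded_bilinear_blinfun_compose])
  have F': "(F has_vector_derivative G x) (at x)" if "\<bar>x\<bar> < r" for x
    using has_vector_derivative_scaleR[OF DERIV_ident NY[OF that]]
    by (simp add: F_def[abs_def] G_def)
  have N_id: "N o\<^sub>L id_blinfun = N" by (intro blinfun_eqI) simp
  have Y0: "Y 0 = id_blinfun" using left[of 0] r by (intro blinfun_eqI) simp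
  then have E0: "E 0 = N o\<^sub>L K" by (intro blinfun_eqI) (simp add: E_def)
  \<comment> \<open>Only the existence of this derivative matters: in \<open>x E(x)\<close> its
    contribution at 0 carries the factor \<open>x = 0\<close>.\<close>
  obtain E' where "(E has_vector_derivative E') (at 0)"
    using bounded_linear.has_vector_derivative[OF
      bounded_bilinear.bounded_linear_right[OF bounded_bilinear_blinfun_compose]
      bounded_bilinear.has_vector_derivative[OF bounded_bilinear_blinfun_compose
        bounded_linear.has_vector_derivative[OF
          bounded_bilinear.bounded_linear_left[OF bounded_bilinear_blinfun_compose]
          Y'[of 0], of K] Y'[of 0]], of N] r
    unfolding E_def[abs_def] by auto
  from has_vector_derivative_diff[OF NY[of 0] has_vector_derivative_scaleR[OF DERIV_ident this]]
  have G': "(G has_vector_derivative - 2 *\<^sub>R (N o\<^sub>L K)) (at 0)"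
    using r by (simp add: G_def[abs_def] E0 scaleR_2)
  let ?h' = "\<lambda>t. vector_derivative h (at t)"
  define U where "U = {t \<in> J. \<bar>h t\<bar> < r}"
  have "U = J \<inter> h -` {-r<..<r}" unfolding U_def by auto
  then have U: "open U" "U \<subseteq> J"
    using smooth_on_continuous_on[OF h(1)] J(1) by (auto intro!: continuous_open_preimage)
  have "\<tau> \<in> U" using J(2) h(2) r by (simp add: U_def)
  have \<Gamma>\<tau>: "\<Gamma> \<tau> = \<Gamma>\<^sub>0" using \<Gamma>[OF J(2)] h(2) plane_1_0 by simp
  let ?A = "\<lambda>t. graph_chart (\<Gamma> \<tau>) D (\<Gamma> t)"
  have A: "?A t = F (h t)" if "t \<in> U" for t
    using chart[of "h t"] \<Gamma>[of t] that \<Gamma>\<tau> by (simp add: U_def)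
  have A': "vector_derivative ?A (at t) = ?h' t *\<^sub>R G (h t)" if "t \<in> U" for t
  proof -
    have "((F \<circ> h) has_vector_derivative ?h' t *\<^sub>R G (h t)) (at t)"
      using that U(2) h(1) by (intro vector_diff_chain_at smooth_on_has_vector_derivative F') (auto simp: U_def)
    then have "(?A has_vector_derivative ?h' t *\<^sub>R G (h t)) (at t)"
      by (rule has_vector_derivative_transform_within_open[OF _ U(1) that]) (simp add: A)
    then show ?thesis by (rule vector_derivative_at)
  qed
  have h2: "(?h' has_vector_derivative nth_deriv 2 h \<tau>) (at \<tau>)"
    using smooth_on_has_vector_derivative[OF smooth_on_vector_derivative[OF h(1)] J(2)]
    by (simp add: nth_deriv_Suc numeral_2_eq_2)
  have "((G \<circ> h) has_vector_derivative ?h' \<tau> *\<^sub>R (- 2 *\<^sub>R (N o\<^sub>L K))) (at \<tau>)"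
    using smooth_on_has_vector_derivative[OF h(1) J(2)] G' h(2) by (intro vector_diff_chain_at) auto
  from has_vector_derivative_scaleR[OF h2[folded has_real_derivative_iff_has_vector_derivative] this]
  have "((\<lambda>t. ?h' t *\<^sub>R G (h t)) has_vector_derivative
      ?h' \<tau> *\<^sub>R ?h' \<tau> *\<^sub>R (- 2 *\<^sub>R (N o\<^sub>L K)) + nth_deriv 2 h \<tau> *\<^sub>R N) (at \<tau>)"
    using h(2) by (simp add: G_def Y0 N_id)
  then have "((\<lambda>t. vector_derivative ?A (at t)) has_vector_derivative
      ?h' \<tau> *\<^sub>R ?h' \<tau> *\<^sub>R (- 2 *\<^sub>R (N o\<^sub>L K)) + nth_deriv 2 h \<tau> *\<^sub>R N) (at \<tau>)"
    by (rule has_vector_derivative_transform_within_open[OF _ U(1) \<open>\<tau> \<in> U\<close>]) (simp add: A')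
  then have cd: "chart_deriv \<Gamma> \<tau> D 2 = ?h' \<tau> *\<^sub>R ?h' \<tau> *\<^sub>R (- 2 *\<^sub>R (N o\<^sub>L K)) + nth_deriv 2 h \<tau> *\<^sub>R N"
    unfolding chart_deriv_def numeral_2_eq_2 nth_deriv_Suc nth_deriv_0 by (rule vector_derivative_at)
  show ?thesis
    unfolding cd using P(3)[OF u] P(3)[OF P(1)]
    by (simp add: Let_def N K blinfun.bilinear_simps power2_eq_square algebra_simps)
qed

text \<open>The derivative Lagrangian is again a point of the cycle, and in its chart the curve is a scalar
  multiple of a fixed map.\<close>

lemma curvature_operator_plane:
  assumes J: "open J" "\<tau> \<in> J" and h: "smooth_on J h" "h \<tau> = 0" "vector_derivative h (at \<tau>) \<noteq> 0"
    and \<Gamma>: "\<And>t. t \<in> J \<Longrightarrow> \<Gamma> t = plane 1 (h t)"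
  obtains c where "\<And>v. v \<in> \<Gamma> \<tau> \<Longrightarrow> curvature_operator \<omega> \<Gamma> \<tau> v = c *\<^sub>R v"
proof -
  let ?h' = "vector_derivative h (at \<tau>)"
  \<comment> \<open>This value makes the vector \<open>h'' u - 2 h'^2 P (B u)\<close> of the second
    derivative equal to \<open>- 2 h'^2 (l u + P (B u))\<close>, which vanishes exactly if
    \<open>l u + B u\<close> lies in the kernel of \<open>P\<close>.\<close>
  define l where "l = - nth_deriv 2 h \<tau> / (2 * ?h'\<^sup>2)"
  have h2: "nth_deriv 2 h \<tau> = - (2 * ?h'\<^sup>2) * l" using h(3) by (simp add: l_def)
  have \<Gamma>\<tau>: "\<Gamma> \<tau> = \<Gamma>\<^sub>0" using \<Gamma>[OF J(2)] h(2) plane_1_0 by simp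
  let ?D = "plane l 1"
  have D: "?D \<in> transversals \<omega> \<Gamma>\<^sub>0"
    using plane_lagrangian[of l 1] plane_Int[of l 0 1 1] plane_1_0 by (simp add: transversals_def)
  have unique: "D = ?D" if D: "D \<in> transversals \<omega> \<Gamma>\<^sub>0" "chart_deriv \<Gamma> \<tau> D 2 = 0" for D
  proof -
    have "\<Gamma>\<^sub>0 \<inter> D = {0}" using transversalsD(2)[OF D(1)] by blast
    obtain P where P: "\<And>w. blinfun_apply P w \<in> \<Gamma>\<^sub>0" "\<And>w. w - P w \<in> D"
      "\<And>w. w \<in> \<Gamma>\<^sub>0 \<Longrightarrow> P w = w" "\<And>w. w \<in> D \<Longrightarrow> P w = 0"
      by (rule lagrangian_projection[OF \<Gamma>\<^sub>0_lagrangian transversalsD(1)[OF D(1)] \<open>\<Gamma>\<^sub>0 \<inter> D = {0}\<close>])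
        (rule that)
    have "l *\<^sub>R u + B u \<in> D" if u: "u \<in> \<Gamma>\<^sub>0" for u
    proof -
      define y where "y = nth_deriv 2 h \<tau> *\<^sub>R u - (2 * ?h'\<^sup>2) *\<^sub>R P (B u)"
      have "B y - P (B y) = 0"
        using chart_deriv_2_plane[OF D(1) P J h(1,2) \<Gamma> u] D(2) by (simp add: Let_def y_def)
      then have "B y \<in> \<Gamma>\<^sub>0" using P(1)[of "B y"] by simp
      \<comment> \<open>\<open>B y = P (B y)\<close> lies both in \<Delta> and in
        \<open>\<Gamma>\<^sub>0\<close>.\<close>
      then have "B y = 0" using B_in_\<Delta>[of y] \<Gamma>\<^sub>0_Int_\<Delta> by blast
      moreover have "y \<in> \<Gamma>\<^sub>0"
        using u P(1) subspace_\<Gamma>\<^sub>0 by (simp add: y_def subspace_diff subspace_scale)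
      ultimately have "y = 0" by (rule B_injective[rotated])
      moreover have "y = - ((2 * ?h'\<^sup>2) *\<^sub>R (l *\<^sub>R u + P (B u)))"
        by (simp add: y_def h2 algebra_simps)
      ultimately have "(2 * ?h'\<^sup>2) *\<^sub>R (l *\<^sub>R u + P (B u)) = 0"
        by (simp only: neg_equal_0_iff_equal)
      then have "P (B u) = - (l *\<^sub>R u)"
        using h(3) by (simp add: eq_neg_iff_add_eq_0 add.commute)
      then show ?thesis using P(2)[of "B u"] by (simp add: add.commute)
    qed
    then have "?D \<subseteq> D" unfolding plane_def by auto
    then have "?D = D"
      using lagrangianD(1,3)[OF transversalsD(1)[OF D(1)]] lagrangianD(1,3)[OF plane_lagrangian[of l 1]]
      by (intro subspace_dim_equal) auto
    then show ?thesis by simp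
  qed
  have "\<Gamma>\<^sub>0 \<inter> ?D = {0}" using transversalsD(2)[OF D] by blast
  obtain P where P: "\<And>w. blinfun_apply P w \<in> \<Gamma>\<^sub>0" "\<And>w. w - P w \<in> ?D"
    "\<And>w. w \<in> \<Gamma>\<^sub>0 \<Longrightarrow> P w = w" "\<And>w. w \<in> ?D \<Longrightarrow> P w = 0"
    by (rule lagrangian_projection[OF \<Gamma>\<^sub>0_lagrangian transversalsD(1)[OF D] \<open>\<Gamma>\<^sub>0 \<inter> ?D = {0}\<close>])
      (rule that)
  have PB: "P (B u) = - (l *\<^sub>R u)" if "u \<in> \<Gamma>\<^sub>0" for u
  proof -
    have "l *\<^sub>R u + B u \<in> ?D" using that unfolding plane_def by auto
    then have "P (l *\<^sub>R u + B u) = 0" by (rule P(4))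
    then show ?thesis using P(3)[OF that] by (simp add: blinfun.bilinear_simps eq_neg_iff_add_eq_0 add.commute)
  qed
  define N where "N = (id_blinfun - P) o\<^sub>L B o\<^sub>L P"
  have N: "N w = B (P w) - P (B (P w))" for w
    by (simp add: N_def blinfun.diff_left)
  \<comment> \<open>Here \<open>P (B u) = - l u\<close>, so the component of
    \<open>u + h B u\<close> in \<open>\<Gamma>\<^sub>0\<close> is \<open>(1 - l h) u\<close>, and
    \<open>h N\<close> has to be divided by this scalar. \<open>U\<close> excludes the times at
    which the curve meets \<open>D\<close>.\<close>
  define m where "m t = h t / (1 - l * h t)" for t
  define U where "U = {t \<in> J. 1 - l * h t \<noteq> 0}"
  have den: "smooth_on J (\<lambda>t. 1 + (- l) * h t)"
    by (intro smooth_on_add smooth_on_const bounded_linear.smooth_on[OF bounded_linear_mult_right] J h(1))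
  have "U = J \<inter> (\<lambda>t. 1 + (- l) * h t) -` (- {0})" unfolding U_def by auto
  then have U: "open U" "U \<subseteq> J"
    using smooth_on_continuous_on[OF den] J(1) by (auto intro!: continuous_open_preimage)
  have "\<tau> \<in> U" using J(2) h(2) by (simp add: U_def)
  have m: "smooth_on U m"
    unfolding m_def[abs_def] using U h(1) den
    by (intro smooth_on_divide) (auto simp: U_def intro: smooth_on_subset)
  have chart: "graph_chart (\<Gamma> \<tau>) ?D (\<Gamma> t) = m t *\<^sub>R N" if t: "t \<in> U" for t
  proof -
    let ?s = "1 - l * h t"
    have s: "?s \<noteq> 0" using t by (simp add: U_def)
    have img: "u + h t *\<^sub>R P (B u) = ?s *\<^sub>R u" if "u \<in> \<Gamma>\<^sub>0" for u
      using PB[OF that] by (simp add: algebra_simps)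
    have "graph_chart \<Gamma>\<^sub>0 ?D (plane 1 (h t)) = m t *\<^sub>R N"
    proof (rule graph_chart_plane[OF D, where P = P])
      show "m t *\<^sub>R N \<in> lin_maps ?D"
        using P(2,4) lagrangianD(1)[OF transversalsD(1)[OF D]]
        by (simp add: lin_maps_def N blinfun.scaleR_left subspace_scale)
      have "(\<lambda>u. u + h t *\<^sub>R P (B u)) ` \<Gamma>\<^sub>0 = (\<lambda>u. ?s *\<^sub>R u) ` \<Gamma>\<^sub>0"
        using img by (intro image_cong) auto
      also have "\<dots> = \<Gamma>\<^sub>0"
      proof (intro equalityI subsetI)
        fix w assume "w \<in> \<Gamma>\<^sub>0"
        then have "inverse ?s *\<^sub>R w \<in> \<Gamma>\<^sub>0" "w = ?s *\<^sub>R (inverse ?s *\<^sub>R w)"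
          using s subspace_\<Gamma>\<^sub>0 by (simp_all add: subspace_scale)
        then show "w \<in> (\<lambda>u. ?s *\<^sub>R u) ` \<Gamma>\<^sub>0" by blast
      qed (use subspace_\<Gamma>\<^sub>0 in \<open>auto intro!: subspace_scale\<close>)
      finally show "(\<lambda>u. u + h t *\<^sub>R P (B u)) ` \<Gamma>\<^sub>0 = \<Gamma>\<^sub>0" .
      show "(m t *\<^sub>R N) (u + h t *\<^sub>R P (B u)) = h t *\<^sub>R (B u - P (B u))" if "u \<in> \<Gamma>\<^sub>0" for u
        unfolding img[OF that] using s P(3)[OF that]
        by (simp add: m_def N blinfun.scaleR_left blinfun.scaleR_right)
    qed
    then show ?thesis using \<Gamma>[of t] t \<Gamma>\<tau> by (simp add: U_def)
  qed
  have derivs: "chart_deriv \<Gamma> \<tau> ?D k = nth_deriv k m \<tau> *\<^sub>R N" for k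
    unfolding chart_deriv_def
    using nth_deriv_cong_open[OF U(1) chart \<open>\<tau> \<in> U\<close>] nth_deriv_scaleR_const[OF U(1) m \<open>\<tau> \<in> U\<close>]
    by simp
  have D2: "chart_deriv \<Gamma> \<tau> ?D 2 = 0"
  proof (rule blinfun_eqI)
    fix w
    have "nth_deriv 2 h \<tau> *\<^sub>R P w - (2 * ?h'\<^sup>2) *\<^sub>R P (B (P w)) = 0"
      by (simp add: PB[OF P(1)] h2)
    then have "chart_deriv \<Gamma> \<tau> ?D 2 (P w) = 0"
      using chart_deriv_2_plane[OF D P J h(1,2) \<Gamma> P(1)] by (simp add: Let_def)
    then show "chart_deriv \<Gamma> \<tau> ?D 2 w = blinfun_apply 0 w"
      unfolding derivs using P(3)[OF P(1)] by (simp add: blinfun.scaleR_left N)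
  qed
  have dl: "derivative_lagrangian \<omega> \<Gamma> \<tau> = ?D"
    unfolding derivative_lagrangian_def \<Gamma>\<tau>
    by (intro the_equality conjI D D2) (erule conjE, rule unique)
  have "(h has_field_derivative ?h') (at \<tau>)"
    using smooth_on_has_vector_derivative[OF h(1) J(2)]
    by (simp add: has_real_derivative_iff_has_vector_derivative)
  \<comment> \<open>As \<open>h\<close> vanishes at \<tau>, the denominator is 1 there and
    contributes nothing to the first derivative.\<close>
  then have "(m has_field_derivative ?h') (at \<tau>)"
    unfolding m_def[abs_def] using h(2) by (auto intro!: derivative_eq_intros)
  then have m1: "nth_deriv 1 m \<tau> = ?h'"
    by (simp add: nth_deriv_Suc has_real_derivative_iff_has_vector_derivative vector_derivative_at)
  have inj: "inj_on (chart_deriv \<Gamma> \<tau> ?D 1) \<Gamma>\<^sub>0"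
  proof (rule inj_onI)
    fix u v assume uv: "u \<in> \<Gamma>\<^sub>0" "v \<in> \<Gamma>\<^sub>0" "chart_deriv \<Gamma> \<tau> ?D 1 u = chart_deriv \<Gamma> \<tau> ?D 1 v"
    \<comment> \<open>On \<open>\<Gamma>\<^sub>0\<close> the map \<open>N\<close> is
      \<open>B u + l u\<close>, the injective parametrization of \<open>D\<close>.\<close>
    then have "l *\<^sub>R u + 1 *\<^sub>R B u = l *\<^sub>R v + 1 *\<^sub>R B v"
      using h(3) P(3) PB unfolding derivs m1 by (simp add: N blinfun.scaleR_left add.commute)
    from plane_coordinates(2)[OF uv(1,2) this] show "u = v" by simp
  qed
  \<comment> \<open>As \<open>m\<close> is a fractional linear function of \<open>h\<close> with
    \<open>m'' = 0\<close> and \<open>m' = h'\<close> at \<tau>, this is the Schwarzian derivative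
    of \<open>h\<close> at \<tau>.\<close>
  define c where "c = nth_deriv 3 m \<tau> / ?h'"
  have "curvature_operator \<omega> \<Gamma> \<tau> v = c *\<^sub>R v" if v: "v \<in> \<Gamma> \<tau>" for v
  proof -
    have "chart_deriv \<Gamma> \<tau> ?D 3 v = chart_deriv \<Gamma> \<tau> ?D 1 (c *\<^sub>R v)"
      using h(3) unfolding derivs m1 by (simp add: c_def blinfun.scaleR_left blinfun.scaleR_right)
    moreover have "c *\<^sub>R v \<in> \<Gamma>\<^sub>0" using v \<Gamma>\<tau> subspace_\<Gamma>\<^sub>0 by (simp add: subspace_scale)
    ultimately show ?thesis
      unfolding curvature_operator_def Let_def dl \<Gamma>\<tau> using inv_into_f_f[OF inj] by simp
  qed
  then show ?thesis by (rule that)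
qed

text \<open>The curvature operator is \<open>c\<close> times the identity, so its trace is
  \<open>c\<close> times the positive dimension of \<open>\<Gamma> \<tau>\<close>; vanishing trace
  forces \<open>c = 0\<close>.\<close>

lemma projective_curvature_zero:
  assumes "reparametrization \<omega> (range (plane 1)) J \<Gamma>" "projective \<omega> J \<Gamma>" "\<tau> \<in> J" "v \<in> \<Gamma> \<tau>"
  shows "curvature_operator \<omega> \<Gamma> \<tau> v = 0"
proof -
  obtain I \<gamma> \<phi> where J: "open J" and \<gamma>: "injective_jacobi_curve_onto \<omega> (range (plane 1)) I \<gamma>"
    and \<phi>: "\<phi> ` J \<subseteq> I" "smooth_on J \<phi>" "\<And>t. t \<in> J \<Longrightarrow> vector_derivative \<phi> (at t) \<noteq> 0"
    and \<Gamma>: "\<And>t. t \<in> J \<Longrightarrow> \<Gamma> t = \<gamma> (\<phi> t)"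
    using assms(1) unfolding reparametrization_def open_interval_def by blast
  have jacobi: "jacobi_curve \<omega> I \<gamma>" "\<gamma> ` I \<subseteq> range (plane 1)" and "open I"
    using \<gamma> by (auto simp: injective_jacobi_curve_onto_def jacobi_curve_def open_interval_def)
  obtain g where g: "smooth_on I g" "\<And>s. s \<in> I \<Longrightarrow> \<gamma> s = plane 1 (g s)"
    "\<And>s. s \<in> I \<Longrightarrow> vector_derivative g (at s) \<noteq> 0"
    by (rule jacobi_curve_in_line[OF jacobi]) (rule that)
  define a where "a = g (\<phi> \<tau>)"
  define h where "h t = g (\<phi> t) + (- a)" for t
  have \<phi>\<tau>: "\<phi> \<tau> \<in> I" using \<phi>(1) assms(3) by blast
  have h: "smooth_on J h" "h \<tau> = 0"
    unfolding h_def using smooth_on_compose[OF J \<open>open I\<close> \<phi>(1) g(1) \<phi>(2)]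
    by (intro smooth_on_add smooth_on_const J) (simp_all add: a_def)
  have "((g \<circ> \<phi>) has_vector_derivative vector_derivative \<phi> (at \<tau>) *\<^sub>R vector_derivative g (at (\<phi> \<tau>))) (at \<tau>)"
    using smooth_on_has_vector_derivative[OF \<phi>(2) assms(3)] smooth_on_has_vector_derivative[OF g(1) \<phi>\<tau>]
    by (rule vector_diff_chain_at)
  from has_vector_derivative_add[OF this has_vector_derivative_const, of "- a"]
  have "(h has_vector_derivative vector_derivative \<phi> (at \<tau>) *\<^sub>R vector_derivative g (at (\<phi> \<tau>))) (at \<tau>)"
    unfolding h_def[abs_def] by simp
  then have h': "vector_derivative h (at \<tau>) \<noteq> 0"
    using \<phi>(3)[OF assms(3)] g(3)[OF \<phi>\<tau>] by (simp add: vector_derivative_at)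
  interpret M: nondegenerate_line \<omega> "plane 1 a" \<Delta> B by (rule shift_origin)
  have \<Gamma>_plane: "\<Gamma> t = M.plane 1 (h t)" if "t \<in> J" for t
    using \<Gamma>[OF that] g(2)[of "\<phi> t"] \<phi>(1) that plane_shift_origin[of a 1 "h t"] by (auto simp: h_def)
  obtain c where c: "\<And>v. v \<in> \<Gamma> \<tau> \<Longrightarrow> curvature_operator \<omega> \<Gamma> \<tau> v = c *\<^sub>R v"
    by (rule M.curvature_operator_plane[OF J assms(3) h h']) (erule \<Gamma>_plane, rule that)
  have "\<Gamma> \<tau> \<in> lagrangian_grassmannian \<omega>"
    using \<Gamma>_plane[OF assms(3)] M.plane_lagrangian[of 1] by simp
  then have "subspace (\<Gamma> \<tau>)" "dim (\<Gamma> \<tau>) \<noteq> 0"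
    using lagrangianD(1,3)[of "\<Gamma> \<tau>" \<omega>] DIM_positive[where 'a='a] by linarith+
  moreover have "trace_on (\<Gamma> \<tau>) (curvature_operator \<omega> \<Gamma> \<tau>) = 0"
    using assms(2,3) by (simp add: projective_def)
  ultimately have "c = 0"
    using trace_on_scaleR[of "\<Gamma> \<tau>" "curvature_operator \<omega> \<Gamma> \<tau>" c] c by simp
  then show ?thesis using c[OF assms(4)] by simp
qed

end

theorem proposition5:
  fixes \<omega> :: "'a::euclidean_space \<Rightarrow> 'a \<Rightarrow> real" and n :: nat and C :: "'a set set"
  assumes "symplectic_form \<omega>" and "DIM('a) = 2 * n" and "regular_cycle \<omega> C"
  shows "\<forall>\<Lambda>\<in>C. is_jacobi_curve_set \<omega> (C - {\<Lambda>}) \<and>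
           (\<forall>J \<Gamma>. reparametrization \<omega> (C - {\<Lambda>}) J \<Gamma> \<longrightarrow> projective \<omega> J \<Gamma> \<longrightarrow>
              (\<forall>t\<in>J. \<forall>v\<in>\<Gamma> t. curvature_operator \<omega> \<Gamma> t v = 0))"
proof
  fix \<Lambda> assume "\<Lambda> \<in> C"
  then obtain \<Gamma>\<^sub>0 \<Delta> B where line: "nondegenerate_line \<omega> \<Gamma>\<^sub>0 \<Delta> B"
    and C: "C - {\<Lambda>} = range (nondegenerate_line.plane \<Gamma>\<^sub>0 B 1)"
    by (rule regular_cycle_remove[OF assms(1,3)])
  interpret nondegenerate_line \<omega> \<Gamma>\<^sub>0 \<Delta> B by fact
  have "is_jacobi_curve_set \<omega> (C - {\<Lambda>})"
    unfolding C is_jacobi_curve_set_def by (intro exI) (rule injective_jacobi_curve_onto_line)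
  then show "is_jacobi_curve_set \<omega> (C - {\<Lambda>}) \<and>
           (\<forall>J \<Gamma>. reparametrization \<omega> (C - {\<Lambda>}) J \<Gamma> \<longrightarrow> projective \<omega> J \<Gamma> \<longrightarrow>
              (\<forall>t\<in>J. \<forall>v\<in>\<Gamma> t. curvature_operator \<omega> \<Gamma> t v = 0))"
    by (intro conjI allI impI ballI) (auto simp: C intro: projective_curvature_zero)
qed

end
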